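(* For $i=1,2$, let $\mathcal{C}_i=(M_i,g_i,J_i)$ be almost Hermitian manifolds, each of which is either Hermitian or nearly Kähler. Let $P\in M_1$, $Q\in M_2$, and let $\theta:(T_PM_1,g_1,J_1)\to(T_QM_2,g_2,J_2)$ be a complex isometry (a linear isometry with $\theta J_1=J_2\theta$). The following assertions are equivalent: 1. $\theta\,\mathcal{J}_{\mathcal{C}_1,P}(\pi)=\mathcal{J}_{\mathcal{C}_2,Q}(\theta\pi)\,\theta$ for all complex lines $\pi\in\mathbb{CP}(T_PM_1,J_{1,P})$. 2. $\theta\,\mathcal{R}_{\mathcal{C}_1,P}(\pi)=\mathcal{R}_{\mathcal{C}_2,Q}(\theta\pi)\,\theta$ for all complex lines $\pi\in\mathbb{CP}(T_PM_1,J_{1,P})$. 3. $\theta^*R_{\mathcal{C}_2,Q}=R_{\mathcal{C}_1,P}$.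
   Context: An almost Hermitian manifold $(M,g,J)$ is a Riemannian manifold $(M,g)$ with an almost complex structure $J$ ($J^2=-\mathrm{id}$) that is unitary: $g(Jx,Jy)=g(x,y)$. It is Hermitian if the Nijenhuis tensor vanishes, i.e. $[X,Y]+J[JX,Y]+J[X,JY]-[JX,JY]=0$ for all vector fields $X,Y$. It is nearly Kähler if $(\nabla_xJ)x=0$ for all tangent vectors $x$, where $\nabla$ is the Levi-Civita connection. Curvature operator: $\mathcal{R}(x,y)=\nabla_x\nabla_y-\nabla_y\nabla_x-\nabla_{[x,y]}$; curvature tensor: $R(x,y,z,w)=g(\mathcal{R}(x,y)z,w)$. Jacobi operator: $\mathcal{J}(x)y=\mathcal{R}(y,x)x$, i.e. $g(\mathcal{J}(x)y,z)=R(y,x,x,z)$. For a vector space $V$ with complex structure $J$, $\mathbb{CP}(V,J)$ is the set of complex lines, i.e. real $2$-dimensional subspaces $\pi\subset V$ with $J\pi=\pi$. For a complex line $\pi$ and any unit vector $x\in\pi$ (so that $\pi=\operatorname{Span}\{x,Jx\}$), the complex Jacobi operator is $\mathcal{J}(\pi):=\mathcal{J}(x)+\mathcal{J}(Jx)$ and the complex curvature operator is $\mathcal{R}(\pi):=\mathcal{R}(x,Jx)$; these do not depend on the choice of the unit vector $x$. Subscripts such as $\mathcal{C}_1,P$ indicate the manifold and the point at which the object is taken. *)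

theory Defs
  imports "HOL-Analysis.Analysis"
begin

section \<open>Smooth maps between Euclidean spaces\<close>

text \<open>Only used on open sets of Euclidean spaces, where the condition on all directional
  derivatives \<open>\<lambda>x. f' x v\<close> is the usual inductive description of \<open>C\<^sup>k\<close>.\<close>

primrec Ck_on :: "nat \<Rightarrow> 'e::euclidean_space set \<Rightarrow> ('e \<Rightarrow> 'f::euclidean_space) \<Rightarrow> bool" where
  "Ck_on 0 S = (\<lambda>f. continuous_on S f)"
| "Ck_on (Suc k) S = (\<lambda>f. (\<forall>x\<in>S. f differentiable (at x)) \<and>
     (\<forall>v. Ck_on k S (\<lambda>x. frechet_derivative f (at x) v)))"

definition smooth_on :: "'e::euclidean_space set \<Rightarrow> ('e \<Rightarrow> 'f::euclidean_space) \<Rightarrow> bool" where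
  "smooth_on S f \<longleftrightarrow> (\<forall>k. Ck_on k S f)"


section \<open>Smooth manifolds\<close>

text \<open>The points of the manifold are all elements of the type \<open>'a\<close>, which carries the topology;
  the Hausdorff and second countability axioms are the sort constraints on \<open>'a\<close>.
  A chart is a domain together with a coordinate map (of which only the values on the domain
  matter). An atlas need not be maximal.\<close>

type_synonym ('a, 'e) chart = "'a set \<times> ('a \<Rightarrow> 'e)"

abbreviation cdom :: "('a, 'e) chart \<Rightarrow> 'a set" where "cdom c \<equiv> fst c"
abbreviation cmap :: "('a, 'e) chart \<Rightarrow> 'a \<Rightarrow> 'e" where "cmap c \<equiv> snd c"
abbreviation cinv :: "('a, 'e) chart \<Rightarrow> 'e \<Rightarrow> 'a" where "cinv c \<equiv> inv_into (cdom c) (cmap c)"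

definition is_chart ::
    "('a::{t2_space,second_countable_topology}, 'e::euclidean_space) chart \<Rightarrow> bool" where
  "is_chart c \<longleftrightarrow> open (cdom c) \<and> open (cmap c ` cdom c) \<and>
     homeomorphism (cdom c) (cmap c ` cdom c) (cmap c) (cinv c)"

definition smooth_atlas ::
    "('a::{t2_space,second_countable_topology}, 'e::euclidean_space) chart set \<Rightarrow> bool" where
  "smooth_atlas A \<longleftrightarrow> (\<forall>c\<in>A. is_chart c) \<and> (\<Union>c\<in>A. cdom c) = UNIV \<and>
     (\<forall>c\<in>A. \<forall>d\<in>A. smooth_on (cmap c ` (cdom c \<inter> cdom d)) (cmap d \<circ> cinv c))"

definition smooth_fun :: "('a, 'e::euclidean_space) chart set \<Rightarrow> ('a \<Rightarrow> real) \<Rightarrow> bool" where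
  "smooth_fun A f \<longleftrightarrow> (\<forall>c\<in>A. smooth_on (cmap c ` cdom c) (f \<circ> cinv c))"

text \<open>A tangent vector at \<open>p\<close> is an equivalence class of pairs (chart around \<open>p\<close>, vector of \<open>'e\<close>)
  under the differentials of the coordinate changes. Each class has exactly one representative
  whose chart is \<open>chart_at A p\<close>, so the tangent space at \<open>p\<close> is the vector space \<open>'e\<close>, a
  vector \<open>v\<close> standing for the class of \<open>(chart_at A p, v)\<close>. Vector fields are therefore
  functions \<open>'a \<Rightarrow> 'e\<close>; since \<open>chart_at A p\<close> depends on \<open>p\<close> in an arbitrary way, their
  smoothness has to be tested on the components in a fixed chart, obtained
  with \<open>tangent_coord\<close>.\<close>

definition chart_at :: "('a, 'e) chart set \<Rightarrow> 'a \<Rightarrow> ('a, 'e) chart" where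
  "chart_at A p = (SOME c. c \<in> A \<and> p \<in> cdom c)"

definition tangent_coord ::
    "('a, 'e::euclidean_space) chart set \<Rightarrow> ('a, 'e) chart \<Rightarrow> 'a \<Rightarrow> 'e \<Rightarrow> 'e" where
  "tangent_coord A c p v =
     frechet_derivative (cmap c \<circ> cinv (chart_at A p)) (at (cmap (chart_at A p) p)) v"

definition field_coord ::
    "('a, 'e::euclidean_space) chart set \<Rightarrow> ('a, 'e) chart \<Rightarrow> ('a \<Rightarrow> 'e) \<Rightarrow> 'e \<Rightarrow> 'e" where
  "field_coord A c X u = tangent_coord A c (cinv c u) (X (cinv c u))"

definition vector_field :: "('a, 'e::euclidean_space) chart set \<Rightarrow> ('a \<Rightarrow> 'e) \<Rightarrow> bool" where
  "vector_field A X \<longleftrightarrow> (\<forall>c\<in>A. smooth_on (cmap c ` cdom c) (field_coord A c X))"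

definition deriv_along ::
    "('a, 'e::euclidean_space) chart set \<Rightarrow> ('a \<Rightarrow> 'e) \<Rightarrow> ('a \<Rightarrow> real) \<Rightarrow> 'a \<Rightarrow> real" where
  "deriv_along A X f p =
     frechet_derivative (f \<circ> cinv (chart_at A p)) (at (cmap (chart_at A p) p)) (X p)"

text \<open>The Lie bracket \<open>[X,Y]\<^sup>i = X\<^sup>j \<partial>\<^sub>j Y\<^sup>i - Y\<^sup>j \<partial>\<^sub>j X\<^sup>i\<close>, evaluated in the chart \<open>chart_at A p\<close>.\<close>

definition lie_bracket ::
    "('a, 'e::euclidean_space) chart set \<Rightarrow> ('a \<Rightarrow> 'e) \<Rightarrow> ('a \<Rightarrow> 'e) \<Rightarrow> 'a \<Rightarrow> 'e" where
  "lie_bracket A X Y p = (let c = chart_at A p in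
     frechet_derivative (field_coord A c Y) (at (cmap c p)) (X p) -
     frechet_derivative (field_coord A c X) (at (cmap c p)) (Y p))"


section \<open>Riemannian metrics and the Levi-Civita connection\<close>

definition riemannian_metric ::
    "('a, 'e::euclidean_space) chart set \<Rightarrow> ('a \<Rightarrow> 'e \<Rightarrow> 'e \<Rightarrow> real) \<Rightarrow> bool" where
  "riemannian_metric A g \<longleftrightarrow>
     (\<forall>p. bilinear (g p) \<and> (\<forall>x y. g p x y = g p y x) \<and> (\<forall>x. x \<noteq> 0 \<longrightarrow> g p x x > 0)) \<and>
     (\<forall>X Y. vector_field A X \<longrightarrow> vector_field A Y \<longrightarrow> smooth_fun A (\<lambda>p. g p (X p) (Y p)))"

text \<open>A connection \<open>D\<close> maps vector fields \<open>X\<close>, \<open>Y\<close> to \<open>D X Y = \<nabla>\<^sub>X Y\<close>; its values on functions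
  that are not (smooth) vector fields are irrelevant.\<close>

definition affine_connection ::
    "('a, 'e::euclidean_space) chart set \<Rightarrow> (('a \<Rightarrow> 'e) \<Rightarrow> ('a \<Rightarrow> 'e) \<Rightarrow> 'a \<Rightarrow> 'e) \<Rightarrow> bool" where
  "affine_connection A D \<longleftrightarrow>
     (\<forall>X Y. vector_field A X \<longrightarrow> vector_field A Y \<longrightarrow> vector_field A (D X Y)) \<and>
     (\<forall>X Y Z. vector_field A X \<longrightarrow> vector_field A Y \<longrightarrow> vector_field A Z \<longrightarrow>
        (\<forall>p. D (\<lambda>q. X q + Y q) Z p = D X Z p + D Y Z p) \<and>
        (\<forall>p. D X (\<lambda>q. Y q + Z q) p = D X Y p + D X Z p)) \<and>
     (\<forall>f X Y. smooth_fun A f \<longrightarrow> vector_field A X \<longrightarrow> vector_field A Y \<longrightarrow>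
        (\<forall>p. D (\<lambda>q. f q *\<^sub>R X q) Y p = f p *\<^sub>R D X Y p) \<and>
        (\<forall>p. D X (\<lambda>q. f q *\<^sub>R Y q) p = deriv_along A X f p *\<^sub>R Y p + f p *\<^sub>R D X Y p))"

definition levi_civita ::
    "('a, 'e::euclidean_space) chart set \<Rightarrow> ('a \<Rightarrow> 'e \<Rightarrow> 'e \<Rightarrow> real) \<Rightarrow>
     (('a \<Rightarrow> 'e) \<Rightarrow> ('a \<Rightarrow> 'e) \<Rightarrow> 'a \<Rightarrow> 'e) \<Rightarrow> bool" where
  "levi_civita A g D \<longleftrightarrow> affine_connection A D \<and>
     (\<forall>X Y. vector_field A X \<longrightarrow> vector_field A Y \<longrightarrow>
        (\<forall>p. D X Y p - D Y X p = lie_bracket A X Y p)) \<and>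
     (\<forall>X Y Z. vector_field A X \<longrightarrow> vector_field A Y \<longrightarrow> vector_field A Z \<longrightarrow>
        (\<forall>p. deriv_along A X (\<lambda>q. g q (Y q) (Z q)) p =
             g p (D X Y p) (Z p) + g p (Y p) (D X Z p)))"


section \<open>Almost Hermitian manifolds\<close>

definition almost_complex ::
    "('a, 'e::euclidean_space) chart set \<Rightarrow> ('a \<Rightarrow> 'e \<Rightarrow> 'e) \<Rightarrow> bool" where
  "almost_complex A J \<longleftrightarrow>
     (\<forall>p. linear (J p) \<and> (\<forall>x. J p (J p x) = - x)) \<and>
     (\<forall>X. vector_field A X \<longrightarrow> vector_field A (\<lambda>p. J p (X p)))"

definition almost_hermitian ::
    "('a::{t2_space,second_countable_topology}, 'e::euclidean_space) chart set \<Rightarrow>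
     ('a \<Rightarrow> 'e \<Rightarrow> 'e \<Rightarrow> real) \<Rightarrow> ('a \<Rightarrow> 'e \<Rightarrow> 'e) \<Rightarrow> bool" where
  "almost_hermitian A g J \<longleftrightarrow>
     smooth_atlas A \<and> riemannian_metric A g \<and> almost_complex A J \<and>
     (\<forall>p x y. g p (J p x) (J p y) = g p x y)"

definition nijenhuis ::
    "('a, 'e::euclidean_space) chart set \<Rightarrow> ('a \<Rightarrow> 'e \<Rightarrow> 'e) \<Rightarrow>
     ('a \<Rightarrow> 'e) \<Rightarrow> ('a \<Rightarrow> 'e) \<Rightarrow> 'a \<Rightarrow> 'e" where
  "nijenhuis A J X Y p = (let JX = (\<lambda>q. J q (X q)); JY = (\<lambda>q. J q (Y q)) in
     lie_bracket A X Y p + J p (lie_bracket A JX Y p) + J p (lie_bracket A X JY p)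
       - lie_bracket A JX JY p)"

definition hermitian :: "('a, 'e::euclidean_space) chart set \<Rightarrow> ('a \<Rightarrow> 'e \<Rightarrow> 'e) \<Rightarrow> bool" where
  "hermitian A J \<longleftrightarrow>
     (\<forall>X Y p. vector_field A X \<longrightarrow> vector_field A Y \<longrightarrow> nijenhuis A J X Y p = 0)"

text \<open>\<open>(\<nabla>\<^sub>x J) y\<close> for tangent vectors \<open>x\<close>, \<open>y\<close> at \<open>p\<close>: the value at \<open>p\<close> of
  \<open>\<nabla>\<^sub>X (J Y) - J (\<nabla>\<^sub>X Y)\<close> for any vector fields \<open>X\<close>, \<open>Y\<close> extending \<open>x\<close>, \<open>y\<close>
  (the expression is tensorial).\<close>

definition nabla_J ::
    "('a, 'e::euclidean_space) chart set \<Rightarrow> (('a \<Rightarrow> 'e) \<Rightarrow> ('a \<Rightarrow> 'e) \<Rightarrow> 'a \<Rightarrow> 'e) \<Rightarrow>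
     ('a \<Rightarrow> 'e \<Rightarrow> 'e) \<Rightarrow> 'a \<Rightarrow> 'e \<Rightarrow> 'e \<Rightarrow> 'e" where
  "nabla_J A D J p x y =
     (THE v. \<exists>X Y. vector_field A X \<and> vector_field A Y \<and> X p = x \<and> Y p = y \<and>
        v = D X (\<lambda>q. J q (Y q)) p - J p (D X Y p))"

definition nearly_kaehler ::
    "('a, 'e::euclidean_space) chart set \<Rightarrow> (('a \<Rightarrow> 'e) \<Rightarrow> ('a \<Rightarrow> 'e) \<Rightarrow> 'a \<Rightarrow> 'e) \<Rightarrow>
     ('a \<Rightarrow> 'e \<Rightarrow> 'e) \<Rightarrow> bool" where
  "nearly_kaehler A D J \<longleftrightarrow> (\<forall>p x. nabla_J A D J p x x = 0)"


section \<open>Curvature\<close>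

text \<open>\<open>\<R>(x,y) z\<close> for tangent vectors at \<open>p\<close>, with the sign convention
  \<open>\<R>(X,Y) = \<nabla>\<^sub>X \<nabla>\<^sub>Y - \<nabla>\<^sub>Y \<nabla>\<^sub>X - \<nabla>\<^bsub>[X,Y]\<^esub>\<close>; again the right-hand side is tensorial, so any
  vector fields extending \<open>x\<close>, \<open>y\<close>, \<open>z\<close> give the same value.\<close>

definition curv_op ::
    "('a, 'e::euclidean_space) chart set \<Rightarrow> (('a \<Rightarrow> 'e) \<Rightarrow> ('a \<Rightarrow> 'e) \<Rightarrow> 'a \<Rightarrow> 'e) \<Rightarrow>
     'a \<Rightarrow> 'e \<Rightarrow> 'e \<Rightarrow> 'e \<Rightarrow> 'e" where
  "curv_op A D p x y z =
     (THE v. \<exists>X Y Z. vector_field A X \<and> vector_field A Y \<and> vector_field A Z \<and>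
        X p = x \<and> Y p = y \<and> Z p = z \<and>
        v = D X (D Y Z) p - D Y (D X Z) p - D (lie_bracket A X Y) Z p)"

definition curv_tensor ::
    "('a, 'e::euclidean_space) chart set \<Rightarrow> ('a \<Rightarrow> 'e \<Rightarrow> 'e \<Rightarrow> real) \<Rightarrow>
     (('a \<Rightarrow> 'e) \<Rightarrow> ('a \<Rightarrow> 'e) \<Rightarrow> 'a \<Rightarrow> 'e) \<Rightarrow> 'a \<Rightarrow> 'e \<Rightarrow> 'e \<Rightarrow> 'e \<Rightarrow> 'e \<Rightarrow> real" where
  "curv_tensor A g D p x y z w = g p (curv_op A D p x y z) w"

definition jacobi_op ::
    "('a, 'e::euclidean_space) chart set \<Rightarrow> (('a \<Rightarrow> 'e) \<Rightarrow> ('a \<Rightarrow> 'e) \<Rightarrow> 'a \<Rightarrow> 'e) \<Rightarrow>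
     'a \<Rightarrow> 'e \<Rightarrow> 'e \<Rightarrow> 'e" where
  "jacobi_op A D p x y = curv_op A D p y x x"

definition complex_lines :: "('e::euclidean_space \<Rightarrow> 'e) \<Rightarrow> 'e set set" where
  "complex_lines J = {L. subspace L \<and> dim L = 2 \<and> J ` L = L}"

text \<open>Some unit vector of the line \<open>L\<close> with respect to the inner product \<open>h\<close>; the two
  operators below do not depend on the choice.\<close>

definition unit_vec :: "('e \<Rightarrow> 'e \<Rightarrow> real) \<Rightarrow> 'e set \<Rightarrow> 'e" where
  "unit_vec h L = (SOME x. x \<in> L \<and> h x x = 1)"

definition complex_jacobi_op ::
    "('a, 'e::euclidean_space) chart set \<Rightarrow> ('a \<Rightarrow> 'e \<Rightarrow> 'e \<Rightarrow> real) \<Rightarrow> ('a \<Rightarrow> 'e \<Rightarrow> 'e) \<Rightarrow>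
     (('a \<Rightarrow> 'e) \<Rightarrow> ('a \<Rightarrow> 'e) \<Rightarrow> 'a \<Rightarrow> 'e) \<Rightarrow> 'a \<Rightarrow> 'e set \<Rightarrow> 'e \<Rightarrow> 'e" where
  "complex_jacobi_op A g J D p L y = (let x = unit_vec (g p) L in
     jacobi_op A D p x y + jacobi_op A D p (J p x) y)"

definition complex_curv_op ::
    "('a, 'e::euclidean_space) chart set \<Rightarrow> ('a \<Rightarrow> 'e \<Rightarrow> 'e \<Rightarrow> real) \<Rightarrow> ('a \<Rightarrow> 'e \<Rightarrow> 'e) \<Rightarrow>
     (('a \<Rightarrow> 'e) \<Rightarrow> ('a \<Rightarrow> 'e) \<Rightarrow> 'a \<Rightarrow> 'e) \<Rightarrow> 'a \<Rightarrow> 'e set \<Rightarrow> 'e \<Rightarrow> 'e" where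
  "complex_curv_op A g J D p L y = (let x = unit_vec (g p) L in curv_op A D p x (J p x) y)"

definition complex_isometry ::
    "('e::euclidean_space \<Rightarrow> 'e \<Rightarrow> real) \<Rightarrow> ('e \<Rightarrow> 'e) \<Rightarrow>
     ('f::euclidean_space \<Rightarrow> 'f \<Rightarrow> real) \<Rightarrow> ('f \<Rightarrow> 'f) \<Rightarrow> ('e \<Rightarrow> 'f) \<Rightarrow> bool" where
  "complex_isometry h1 j1 h2 j2 \<theta> \<longleftrightarrow>
     linear \<theta> \<and> bij \<theta> \<and> (\<forall>x y. h2 (\<theta> x) (\<theta> y) = h1 x y) \<and> \<theta> \<circ> j1 = j2 \<circ> \<theta>"

end

theory Submission
  imports Defs "HOL-Real_Asymp.Real_Asymp"
begin

text \<open>Let \<open>T = \<theta>\<^sup>*R\<^sub>2 - R\<^sub>1\<close>, an algebraic curvature tensor on \<open>T\<^sub>PM\<^sub>1\<close>. Polarized over all complex lines,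
  each of the first two conditions, together with the Bianchi identity, forces the complex multilinear
  extension of \<open>T\<close> to live only on quadruples of vectors that are all of type \<open>(1,0)\<close> or all of type
  \<open>(0,1)\<close>. Exactly this component is killed by Gray's identity, which both curvature tensors satisfy,
  so \<open>T = 0\<close>. Gray's identity comes from the Ricci identity
  \<open>R(x,y)J - JR(x,y) = \<nabla>\<^sup>2\<^sub>x\<^sub>yJ - \<nabla>\<^sup>2\<^sub>y\<^sub>xJ\<close>: in the Hermitian case \<open>\<nabla>\<^bsub>Jx\<^esub>J = J\<nabla>\<^sub>xJ\<close>, and in the nearly
  Kaehler case \<open>g((\<nabla>\<^sup>2\<^sub>x\<^sub>yJ)z, w)\<close> is skew in \<open>y, z, w\<close>.\<close>

section \<open>Calculus of \<open>C\<^sup>k\<close> maps\<close>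

text \<open>The definitions dictate much of the work. \<open>curv_op\<close> and
  \<open>nabla_J\<close> are \<open>THE\<close> descriptions over global vector fields extending the
  given vectors: bump functions make such extensions exist, and tensoriality makes the described
  value unique. The value of a field at q is written in \<open>chart_at A q\<close>, which jumps
  with q, so derivatives are first moved to a fixed chart. Tensoriality of the curvature and the
  Bianchi identity both rest on [X,Y] acting as a commutator of derivations, hence on the symmetry
  of second derivatives.

  Complex types are never introduced in the algebra. A curvature tensor is determined by the values
  k = T(x,y,y,x), so Gray's identity is only evaluated at x, y, y, x. There either hypothesis fixes
  all other terms as multiples of k: one side of the identity becomes 4k, the other -4k, and k =
  0.\<close>

lemma frechet_derivative_cong_open:
  assumes "open S" "x \<in> S" "\<And>y. y \<in> S \<Longrightarrow> f y = g y"
  shows "frechet_derivative f (at x) = frechet_derivative g (at x)"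
proof -
  have "(f has_derivative f') (at x) \<longleftrightarrow> (g has_derivative f') (at x)" for f'
    using has_derivative_transform_within_open[OF _ assms(1,2)] assms(3) by metis
  then show ?thesis unfolding frechet_derivative_def by simp
qed

lemma differentiable_cong_open:
  assumes "open S" "x \<in> S" "\<And>y. y \<in> S \<Longrightarrow> f y = g y" "f differentiable at x"
  shows "g differentiable at x"
  using assms has_derivative_transform_within_open[OF _ assms(1,2)]
  unfolding differentiable_def by metis

lemma Ck_on_cong:
  assumes "open S"
  shows "Ck_on k S f \<Longrightarrow> (\<And>x. x \<in> S \<Longrightarrow> f x = g x) \<Longrightarrow> Ck_on k S g"
proof (induction k arbitrary: f g)
  case 0
  then show ?case using continuous_on_cong[of S S f g] by simp
next
  case (Suc k)
  have "g differentiable at x" if "x \<in> S" for x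
    using differentiable_cong_open[OF assms that, of f g] Suc.prems that by simp
  moreover have "Ck_on k S (\<lambda>x. frechet_derivative g (at x) v)" for v
  proof (rule Suc.IH)
    show "Ck_on k S (\<lambda>x. frechet_derivative f (at x) v)" using Suc.prems by simp
    show "frechet_derivative f (at x) v = frechet_derivative g (at x) v" if "x \<in> S" for x
      using frechet_derivative_cong_open[OF assms that, of f g] Suc.prems(2) by simp
  qed
  ultimately show ?case by simp
qed

text \<open>Allows any explicit derivative, so the closure properties below can quote the usual
  derivative rules; \<open>Ck_on_cong\<close> then passes to \<open>frechet_derivative\<close>,
  which agrees with the given derivative on \<open>S\<close>.\<close>

lemma Ck_on_has_derivativeI:
  assumes S: "open S"
    and der: "\<And>x. x \<in> S \<Longrightarrow> (f has_derivative f' x) (at x)"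
    and Ck: "\<And>v. Ck_on k S (\<lambda>x. f' x v)"
  shows "Ck_on (Suc k) S f"
proof -
  have "frechet_derivative f (at x) = f' x" if "x \<in> S" for x
    using frechet_derivative_at[OF der[OF that]] by simp
  then have "Ck_on k S (\<lambda>x. frechet_derivative f (at x) v)" for v
    using Ck_on_cong[OF S Ck[of v]] by simp
  moreover have "\<forall>x\<in>S. f differentiable at x"
    using der unfolding differentiable_def by blast
  ultimately show ?thesis by simp
qed

lemma Ck_on_has_derivative:
  assumes "Ck_on (Suc k) S f" "x \<in> S"
  shows "(f has_derivative frechet_derivative f (at x)) (at x)"
  using assms by (simp add: frechet_derivative_works)

lemma Ck_on_subset: "Ck_on k S f \<Longrightarrow> T \<subseteq> S \<Longrightarrow> Ck_on k T f"
  by (induction k arbitrary: f) (auto intro: continuous_on_subset)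

lemma Ck_on_Suc_imp: "Ck_on (Suc k) S f \<Longrightarrow> Ck_on k S f"
proof (induction k arbitrary: f)
  case 0
  then show ?case
    by (auto intro!: continuous_at_imp_continuous_on differentiable_imp_continuous_within)
qed simp

lemma Ck_on_local:
  assumes "\<And>x. x \<in> S \<Longrightarrow> \<exists>T. open T \<and> x \<in> T \<and> Ck_on k T f"
  shows "Ck_on k S f"
  using assms
proof (induction k arbitrary: f)
  case 0
  have "isCont f x" if "x \<in> S" for x
    using 0[OF that] by (auto simp: continuous_on_eq_continuous_at)
  then show ?case by (simp add: continuous_at_imp_continuous_on)
next
  case (Suc k)
  have "f differentiable at x" if "x \<in> S" for x
    using Suc.prems[OF that] by auto
  moreover have "Ck_on k S (\<lambda>x. frechet_derivative f (at x) v)" for v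
    by (rule Suc.IH) (use Suc.prems in fastforce)
  ultimately show ?case by simp
qed

lemma Ck_on_const: "Ck_on k S (\<lambda>x. c)"
  by (induction k arbitrary: c) auto

lemma Ck_on_linear:
  assumes "open S" "bounded_linear f"
  shows "Ck_on k S f"
proof (cases k)
  case 0
  then show ?thesis using assms by (simp add: linear_continuous_on)
next
  case (Suc m)
  have "Ck_on (Suc m) S f"
    using assms by (intro Ck_on_has_derivativeI[of S f "\<lambda>x. f"] Ck_on_const bounded_linear_imp_has_derivative)
  then show ?thesis using Suc by simp
qed

lemma Ck_on_add:
  assumes "open S"
  shows "Ck_on k S f \<Longrightarrow> Ck_on k S g \<Longrightarrow> Ck_on k S (\<lambda>x. f x + g x)"
proof (induction k arbitrary: f g)
  case (Suc k)
  show ?case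
  proof (rule Ck_on_has_derivativeI[OF assms])
    fix x assume "x \<in> S"
    then show "((\<lambda>x. f x + g x) has_derivative (\<lambda>v. frechet_derivative f (at x) v + frechet_derivative g (at x) v)) (at x)"
      using Suc.prems by (intro has_derivative_add Ck_on_has_derivative)
  qed (use Suc in simp)
qed (simp add: continuous_on_add)

lemma Ck_on_scaleR:
  fixes f :: "'a::euclidean_space \<Rightarrow> real"
  assumes "open S"
  shows "Ck_on k S f \<Longrightarrow> Ck_on k S g \<Longrightarrow> Ck_on k S (\<lambda>x. f x *\<^sub>R g x)"
proof (induction k arbitrary: f g)
  case (Suc k)
  show ?case
  proof (rule Ck_on_has_derivativeI[OF assms])
    fix x assume "x \<in> S"
    then show "((\<lambda>x. f x *\<^sub>R g x) has_derivative (\<lambda>v. f x *\<^sub>R frechet_derivative g (at x) v + frechet_derivative f (at x) v *\<^sub>R g x)) (at x)"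
      using Suc.prems by (intro has_derivative_scaleR Ck_on_has_derivative)
  next
    fix v
    show "Ck_on k S (\<lambda>x. f x *\<^sub>R frechet_derivative g (at x) v + frechet_derivative f (at x) v *\<^sub>R g x)"
      using Suc.prems by (intro Ck_on_add[OF assms] Suc.IH Ck_on_Suc_imp[OF Suc.prems(1)] Ck_on_Suc_imp[OF Suc.prems(2)]) simp_all
  qed
qed (simp add: continuous_on_scaleR)

lemma Ck_on_mult:
  fixes f :: "'a::euclidean_space \<Rightarrow> real"
  assumes "open S" "Ck_on k S f" "Ck_on k S g"
  shows "Ck_on k S (\<lambda>x. f x * g x)"
  using Ck_on_scaleR[OF assms] by simp

lemma Ck_on_sum:
  assumes "open S" "\<And>i. i \<in> I \<Longrightarrow> Ck_on k S (f i)"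
  shows "Ck_on k S (\<lambda>x. \<Sum>i\<in>I. f i x)"
  using assms(2) by (induction I rule: infinite_finite_induct) (simp_all add: Ck_on_const Ck_on_add[OF assms(1)])

lemma Ck_on_inner_const:
  assumes "open S"
  shows "Ck_on k S f \<Longrightarrow> Ck_on k S (\<lambda>x. f x \<bullet> b)"
proof (induction k arbitrary: f)
  case (Suc k)
  show ?case
  proof (rule Ck_on_has_derivativeI[OF assms])
    fix x assume "x \<in> S"
    then show "((\<lambda>x. f x \<bullet> b) has_derivative (\<lambda>v. frechet_derivative f (at x) v \<bullet> b)) (at x)"
      using Suc.prems by (intro has_derivative_inner_left Ck_on_has_derivative)
  qed (use Suc in simp)
qed (simp add: continuous_on_inner)

lemma linear_basis_expansion:
  fixes f :: "'a::euclidean_space \<Rightarrow> 'b::real_vector"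
  assumes "linear f"
  shows "f v = (\<Sum>b\<in>Basis. (v \<bullet> b) *\<^sub>R f b)"
proof -
  have "f v = f (\<Sum>b\<in>Basis. (v \<bullet> b) *\<^sub>R b)" by (simp add: euclidean_representation)
  also have "\<dots> = (\<Sum>b\<in>Basis. (v \<bullet> b) *\<^sub>R f b)" 
    by (simp add: linear_sum[OF assms] linear_scale[OF assms])
  finally show ?thesis .
qed

text \<open>\<open>Ck_on\<close> speaks about constant directions only. A direction that moves with
  the point is expanded in \<open>Basis\<close>, which leaves products of components with
  derivatives in constant directions.\<close>

lemma Ck_on_derivative_along:
  assumes "open S" "Ck_on (Suc k) S f" "Ck_on k S g"
  shows "Ck_on k S (\<lambda>x. frechet_derivative f (at x) (g x))"
proof -
  have *: "frechet_derivative f (at x) (g x) = (\<Sum>b\<in>Basis. (g x \<bullet> b) *\<^sub>R frechet_derivative f (at x) b)"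
    if "x \<in> S" for x
  proof -
    have "linear (frechet_derivative f (at x))"
      using Ck_on_has_derivative[OF assms(2) that] has_derivative_linear by blast
    then show ?thesis by (rule linear_basis_expansion)
  qed
  have "Ck_on k S (\<lambda>x. \<Sum>b\<in>Basis. (g x \<bullet> b) *\<^sub>R frechet_derivative f (at x) b)"
    using assms by (intro Ck_on_sum Ck_on_scaleR Ck_on_inner_const) auto
  from Ck_on_cong[OF assms(1) this] show ?thesis using * by simp
qed

text \<open>The chain rule differentiates \<open>f\<close> in a direction that depends on the point;
  after expansion in \<open>Basis\<close> the induction hypothesis applies to the directional
  derivatives of \<open>f\<close>, with the same inner map \<open>g\<close>.\<close>

lemma Ck_on_compose:
  assumes "open S" "open T" "g ` S \<subseteq> T"
  shows "Ck_on k T f \<Longrightarrow> Ck_on k S g \<Longrightarrow> Ck_on k S (\<lambda>x. f (g x))"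
proof (induction k arbitrary: f)
  case 0
  then show ?case using assms by (auto intro: continuous_on_compose2)
next
  case (Suc k)
  let ?g' = "\<lambda>x v. frechet_derivative g (at x) v"
  let ?f' = "\<lambda>x v. frechet_derivative f (at x) v"
  show ?case
  proof (rule Ck_on_has_derivativeI[OF assms(1)])
    fix x assume x: "x \<in> S"
    have "(f has_derivative ?f' (g x)) (at (g x))" 
      using x assms(3) by (intro Ck_on_has_derivative[OF Suc.prems(1)]) auto
    from has_derivative_compose[OF Ck_on_has_derivative[OF Suc.prems(2) x] this]
    have d: "((\<lambda>x. f (g x)) has_derivative (\<lambda>v. ?f' (g x) (?g' x v))) (at x)" .
    have "linear (?f' (g x))"
      using \<open>(f has_derivative ?f' (g x)) (at (g x))\<close> has_derivative_linear by blast
    then have "?f' (g x) (?g' x v) = (\<Sum>b\<in>Basis. (?g' x v \<bullet> b) *\<^sub>R ?f' (g x) b)" for v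
      by (rule linear_basis_expansion)
    then show "((\<lambda>x. f (g x)) has_derivative (\<lambda>v. \<Sum>b\<in>Basis. (?g' x v \<bullet> b) *\<^sub>R ?f' (g x) b)) (at x)"
      using d by simp
  next
    fix v
    show "Ck_on k S (\<lambda>x. \<Sum>b\<in>Basis. (?g' x v \<bullet> b) *\<^sub>R ?f' (g x) b)"
      using Suc.prems
      by (intro Ck_on_sum Ck_on_scaleR Ck_on_inner_const assms Suc.IH Ck_on_Suc_imp[OF Suc.prems(2)]) auto
  qed
qed

section \<open>Bump functions\<close>

definition flat :: "nat \<Rightarrow> real \<Rightarrow> real" where
  "flat n t = (if t \<le> 0 then 0 else exp (- 1 / t) / t ^ n)"

lemma flat_has_real_derivative:
  "(flat n has_real_derivative (flat (n + 2) t - real n * flat (n + 1) t)) (at t)"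
proof -
  consider "t < 0" | "t = 0" | "t > 0" by linarith
  then show ?thesis
  proof cases
    case 1
    have "((\<lambda>_. 0) has_real_derivative 0) (at t)" by simp
    then have "(flat n has_real_derivative 0) (at t)"
      by (rule has_field_derivative_transform_within_open[of _ _ _ "{..<0}"]) (use 1 in \<open>auto simp: flat_def\<close>)
    with 1 show ?thesis by (simp add: flat_def)
  next
    case 3
    have e: "((\<lambda>t. exp (- 1 / t)) has_real_derivative exp (- 1 / t) / t ^ 2) (at t)"
      using 3 by (auto intro!: derivative_eq_intros simp: power2_eq_square)
    have "((\<lambda>t. exp (- 1 / t) / t ^ n) has_real_derivative
        (exp (- 1 / t) / t ^ 2 * t ^ n - exp (- 1 / t) * (real n * t ^ (n - 1))) / (t ^ n * t ^ n)) (at t)"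
      using 3 DERIV_divide[OF e DERIV_pow[of n t]] by simp
    moreover have "(exp (- 1 / t) / t ^ 2 * t ^ n - exp (- 1 / t) * (real n * t ^ (n - 1))) / (t ^ n * t ^ n)
        = flat (n + 2) t - real n * flat (n + 1) t"
      using 3 by (cases n) (simp_all add: flat_def power_add power2_eq_square divide_simps, simp add: algebra_simps)
    ultimately have "((\<lambda>t. exp (- 1 / t) / t ^ n) has_real_derivative (flat (n + 2) t - real n * flat (n + 1) t)) (at t)"
      by simp
    then show ?thesis
      by (rule has_field_derivative_transform_within_open[of _ _ _ "{0<..}"]) (use 3 in \<open>auto simp: flat_def\<close>)
  next
    case 2
    have "((\<lambda>h. exp (- 1 / h) / h ^ n / h) \<longlongrightarrow> 0) (at_right (0::real))"
      by real_asymp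
    then have "((\<lambda>h. flat n h / h) \<longlongrightarrow> 0) (at_right 0)"
      by (rule Lim_transform_eventually) (auto simp: flat_def eventually_at_filter)
    moreover have "((\<lambda>h. flat n h / h) \<longlongrightarrow> 0) (at_left 0)"
      by (rule Lim_transform_eventually[OF tendsto_const]) (auto simp: flat_def eventually_at_filter)
    ultimately have "((\<lambda>h. flat n h / h) \<longlongrightarrow> 0) (at 0)" 
      using filterlim_split_at by blast
    then show ?thesis using 2 by (simp add: DERIV_def flat_def)
  qed
qed

text \<open>The powers of 1/t in \<open>flat\<close> are there so that each derivative is a linear
  combination of members of the same family; the induction can then run over all \<open>n\<close> at
  once.\<close>

lemma Ck_on_flat: "Ck_on k UNIV (flat n)"
proof (induction k arbitrary: n)
  case 0
  then show ?case
    using DERIV_isCont[OF flat_has_real_derivative] by (simp add: continuous_at_imp_continuous_on)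
next
  case (Suc k)
  show ?case
  proof (rule Ck_on_has_derivativeI)
    show "(flat n has_derivative (\<lambda>v. (flat (n + 2) t + (- real n) * flat (n + 1) t) * v)) (at t)" for t
      using flat_has_real_derivative[of n t] by (simp add: has_field_derivative_def)
    show "Ck_on k UNIV (\<lambda>t. (flat (n + 2) t + (- real n) * flat (n + 1) t) * v)" for v
      by (intro Ck_on_mult Ck_on_add Ck_on_const Suc open_UNIV)
  qed simp
qed

lemma smooth_bump_exists:
  fixes a :: "'a::euclidean_space"
  assumes "r > 0"
  obtains \<eta> :: "'a \<Rightarrow> real" where "smooth_on UNIV \<eta>" "\<eta> a = 1" "\<And>x. x \<notin> ball a r \<Longrightarrow> \<eta> x = 0"
proof -
  \<comment> \<open>This is r^2 - |x - a|^2, spelled out with sums and products so that the closure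
    rules for \<open>Ck_on\<close> match it. It is positive exactly inside the ball, where
    \<open>flat 0\<close> does not vanish; division by the value \<open>flat 0\<close> takes at r^2
    normalizes the bump at the centre.\<close>
  let ?s = "\<lambda>x. r\<^sup>2 + (- 1) * (\<Sum>b\<in>Basis. ((x + (- a)) \<bullet> b) * ((x + (- a)) \<bullet> b))"
  have s: "?s x = r\<^sup>2 - (dist a x)\<^sup>2" for x
  proof -
    have "(dist a x)\<^sup>2 = (x + - a) \<bullet> (x + - a)"
      by (metis dist_commute dist_norm power2_norm_eq_inner diff_conv_add_uminus)
    then show ?thesis unfolding euclidean_inner[of "x + - a" "x + - a"] by simp
  qed
  have "Ck_on k UNIV ?s" for k
    by (intro Ck_on_add Ck_on_mult Ck_on_sum Ck_on_inner_const Ck_on_const Ck_on_linear bounded_linear_ident open_UNIV)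
  then have "Ck_on k UNIV (\<lambda>x. flat 0 (?s x))" for k
    by (rule Ck_on_compose[OF open_UNIV open_UNIV subset_UNIV Ck_on_flat])
  then have "Ck_on k UNIV (\<lambda>x. flat 0 (?s x) * (1 / flat 0 (r\<^sup>2)))" for k
    by (rule Ck_on_mult[OF open_UNIV _ Ck_on_const])
  then have "smooth_on UNIV (\<lambda>x. flat 0 (?s x) * (1 / flat 0 (r\<^sup>2)))"
    unfolding smooth_on_def by blast
  moreover have "flat 0 (?s a) * (1 / flat 0 (r\<^sup>2)) = 1"
    using assms by (simp add: s flat_def)
  moreover have "flat 0 (?s x) * (1 / flat 0 (r\<^sup>2)) = 0" if "x \<notin> ball a r" for x
  proof -
    have "r\<^sup>2 \<le> (dist a x)\<^sup>2" using that assms by (auto intro!: power_mono)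
    then show ?thesis unfolding s by (simp add: flat_def)
  qed
  ultimately show ?thesis using that by blast
qed

section \<open>Symmetry of second derivatives\<close>

lemma second_difference_mean_value:
  fixes f :: "'a::euclidean_space \<Rightarrow> real"
  assumes "h > 0"
    and S: "\<And>s t. 0 \<le> s \<Longrightarrow> s \<le> h \<Longrightarrow> 0 \<le> t \<Longrightarrow> t \<le> h \<Longrightarrow> x + s *\<^sub>R u + t *\<^sub>R v \<in> S"
    and f': "\<And>y. y \<in> S \<Longrightarrow> (f has_derivative f' y) (at y)"
    and f'': "\<And>y. y \<in> S \<Longrightarrow> ((\<lambda>y. f' y u) has_derivative f'' y) (at y)"
  shows "\<exists>s t. 0 < s \<and> s < h \<and> 0 < t \<and> t < h \<and>
     f (x + h *\<^sub>R u + h *\<^sub>R v) - f (x + h *\<^sub>R u) - f (x + h *\<^sub>R v) + f x = h * h * f'' (x + s *\<^sub>R u + t *\<^sub>R v) v"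
proof -
  have lin: "((\<lambda>s. a + s *\<^sub>R w + b) has_derivative (\<lambda>k. k *\<^sub>R w)) (at s)" for a b w :: 'a and s :: real
    by (auto intro!: derivative_eq_intros)
  have d: "((\<lambda>s. g (a + s *\<^sub>R w + b)) has_real_derivative g' w) (at s)"
    if "(g has_derivative g') (at (a + s *\<^sub>R w + b))" for g :: "'a \<Rightarrow> real" and g' a b w s
  proof -
    have "((\<lambda>s. g (a + s *\<^sub>R w + b)) has_derivative (\<lambda>k. g' (k *\<^sub>R w))) (at s)"
      using has_derivative_compose[OF lin that] .
    moreover have "g' (k *\<^sub>R w) = g' w * k" for k
      using linear_scale[OF has_derivative_linear[OF that]] by simp
    ultimately show ?thesis by (simp add: has_field_derivative_def)
  qed
  \<comment> \<open>The second difference is an ordinary first difference of this function. The mean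
    value theorem along \<open>u\<close> produces a difference of values of \<open>f' _ u\<close>,
    and a second application along \<open>v\<close> produces \<open>f''\<close>.\<close>
  define \<phi> where "\<phi> s = f (x + s *\<^sub>R u + h *\<^sub>R v) - f (x + s *\<^sub>R u)" for s
  have "(\<phi> has_real_derivative f' (x + s *\<^sub>R u + h *\<^sub>R v) u - f' (x + s *\<^sub>R u) u) (at s)" if "0 \<le> s" "s \<le> h" for s
    unfolding \<phi>_def
    using d[of f "f' (x + s *\<^sub>R u + h *\<^sub>R v)" x s u "h *\<^sub>R v"] d[of f "f' (x + s *\<^sub>R u)" x s u 0]
      f'[OF S[of s h]] f'[OF S[of s 0]] that assms(1) by (auto intro!: DERIV_diff)
  from MVT2[OF assms(1) this] obtain s where s: "0 < s" "s < h"
    and eq1: "\<phi> h - \<phi> 0 = h * (f' (x + s *\<^sub>R u + h *\<^sub>R v) u - f' (x + s *\<^sub>R u) u)" by auto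
  have "((\<lambda>t. f' (x + s *\<^sub>R u + t *\<^sub>R v) u) has_real_derivative f'' (x + s *\<^sub>R u + t *\<^sub>R v) v) (at t)"
    if "0 \<le> t" "t \<le> h" for t
    using d[of "\<lambda>y. f' y u" "f'' (x + s *\<^sub>R u + t *\<^sub>R v)" "x + s *\<^sub>R u" t v 0] f''[OF S[of s t]] s that by auto
  from MVT2[OF assms(1) this] obtain t where t: "0 < t" "t < h"
    and eq2: "f' (x + s *\<^sub>R u + h *\<^sub>R v) u - f' (x + s *\<^sub>R u) u = h * f'' (x + s *\<^sub>R u + t *\<^sub>R v) v" by auto
  show ?thesis using s t eq1 unfolding eq2 \<phi>_def by (intro exI[of _ s] exI[of _ t]) auto
qed

text \<open>The second difference is symmetric in \<open>u\<close> and \<open>v\<close>, so both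
  mixed derivatives take a common value at suitable, possibly different, points near
  \<open>x\<close>. By continuity they differ at \<open>x\<close> by less than any
  \<open>e\<close>.\<close>

lemma frechet_derivative_commute:
  fixes f :: "'a::euclidean_space \<Rightarrow> real"
  assumes "open S" "x \<in> S" and f: "Ck_on (Suc (Suc 0)) S f"
  shows "frechet_derivative (\<lambda>y. frechet_derivative f (at y) u) (at x) v =
         frechet_derivative (\<lambda>y. frechet_derivative f (at y) v) (at x) u"
proof -
  define f2 where "f2 a b y = frechet_derivative (\<lambda>y. frechet_derivative f (at y) a) (at y) b" for a b y
  have C1: "Ck_on (Suc 0) S (\<lambda>y. frechet_derivative f (at y) a)" for a
    using f by simp
  have cont: "continuous_on S (f2 a b)" for a b
    using C1[of a] unfolding f2_def by simp
  have d1: "(f has_derivative frechet_derivative f (at y)) (at y)" if "y \<in> S" for y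
    using Ck_on_has_derivative[OF f that] .
  have d2: "((\<lambda>y. frechet_derivative f (at y) a) has_derivative (\<lambda>b. f2 a b y)) (at y)" if "y \<in> S" for y a
    using Ck_on_has_derivative[OF C1 that, of a] unfolding f2_def by simp
  have "\<bar>f2 u v x - f2 v u x\<bar> \<le> e" if "e > 0" for e
  proof -
    have "isCont (f2 a b) x" for a b
      using cont assms(1,2) continuous_on_eq_continuous_at by blast
    then have *: "\<exists>d>0. \<forall>y. dist y x < d \<longrightarrow> dist (f2 a b y) (f2 a b x) < e / 2" for a b
      using \<open>e > 0\<close> unfolding continuous_at_eps_delta by (metis half_gt_zero)
    obtain d1' where d1': "d1' > 0" "\<And>y. dist y x < d1' \<Longrightarrow> dist (f2 u v y) (f2 u v x) < e / 2"
      using *[of u v] by blast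
    obtain d2' where d2': "d2' > 0" "\<And>y. dist y x < d2' \<Longrightarrow> dist (f2 v u y) (f2 v u x) < e / 2"
      using *[of v u] by blast
    obtain d3 where d3: "d3 > 0" "ball x d3 \<subseteq> S"
      using assms(1,2) open_contains_ball by blast
    define \<delta> where "\<delta> = min d1' (min d2' d3)"
    have "\<delta> > 0" using d1' d2' d3 by (simp add: \<delta>_def)
    \<comment> \<open>The summand 1 avoids a division by zero when both directions vanish, and makes
      the estimate in \<open>near\<close> strict.\<close>
    define h where "h = \<delta> / (norm u + norm v + 1)"
    have N: "norm u + norm v + 1 > 0" using norm_ge_zero[of u] norm_ge_zero[of v] by linarith
    have h: "h > 0" using \<open>\<delta> > 0\<close> N by (simp add: h_def)
    have near: "dist (x + s *\<^sub>R a + t *\<^sub>R b) x < \<delta>"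
      if st: "0 \<le> s" "s \<le> h" "0 \<le> t" "t \<le> h" and ab: "norm a + norm b = norm u + norm v" for s t a b
    proof -
      have "dist (x + s *\<^sub>R a + t *\<^sub>R b) x = norm (s *\<^sub>R a + t *\<^sub>R b)" by (simp add: dist_norm)
      also have "\<dots> \<le> s * norm a + t * norm b"
        using norm_triangle_ineq[of "s *\<^sub>R a" "t *\<^sub>R b"] st by simp
      also have "\<dots> \<le> h * norm a + h * norm b"
        using st by (intro add_mono mult_right_mono) auto
      also have "\<dots> = h * (norm u + norm v)" by (simp add: ab flip: distrib_left)
      also have "\<dots> < h * (norm u + norm v + 1)" using h by simp
      also have "\<dots> = \<delta>" using N by (simp add: h_def)
      finally show ?thesis .
    qed
    have S: "x + s *\<^sub>R a + t *\<^sub>R b \<in> S"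
      if "0 \<le> s" "s \<le> h" "0 \<le> t" "t \<le> h" "norm a + norm b = norm u + norm v" for s t a b
      using near[OF that] d3(2) by (auto simp: \<delta>_def dist_commute)
    obtain s t where st: "0 < s" "s < h" "0 < t" "t < h"
      "f (x + h *\<^sub>R u + h *\<^sub>R v) - f (x + h *\<^sub>R u) - f (x + h *\<^sub>R v) + f x = h * h * f2 u v (x + s *\<^sub>R u + t *\<^sub>R v)"
      using second_difference_mean_value[OF h S d1 d2, of u v] by auto
    obtain s' t' where st': "0 < s'" "s' < h" "0 < t'" "t' < h"
      "f (x + h *\<^sub>R v + h *\<^sub>R u) - f (x + h *\<^sub>R v) - f (x + h *\<^sub>R u) + f x = h * h * f2 v u (x + s' *\<^sub>R v + t' *\<^sub>R u)"
      using second_difference_mean_value[OF h S d1 d2, of v u] by (auto simp: add.commute)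
    have swap: "x + h *\<^sub>R v + h *\<^sub>R u = x + h *\<^sub>R u + h *\<^sub>R v" by (simp add: ac_simps)
    have "h * h * f2 u v (x + s *\<^sub>R u + t *\<^sub>R v) = h * h * f2 v u (x + s' *\<^sub>R v + t' *\<^sub>R u)"
      using st(5) st'(5) unfolding swap by linarith
    then have "f2 u v (x + s *\<^sub>R u + t *\<^sub>R v) = f2 v u (x + s' *\<^sub>R v + t' *\<^sub>R u)" using h by simp
    moreover have "dist (f2 u v (x + s *\<^sub>R u + t *\<^sub>R v)) (f2 u v x) < e / 2"
      using near[of s t u v] st by (intro d1') (auto simp: \<delta>_def)
    moreover have "dist (f2 v u (x + s' *\<^sub>R v + t' *\<^sub>R u)) (f2 v u x) < e / 2"
      using near[of s' t' v u] st' by (intro d2') (auto simp: \<delta>_def)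
    ultimately show ?thesis unfolding dist_real_def by linarith
  qed
  then have "\<bar>f2 u v x - f2 v u x\<bar> \<le> 0" by (meson field_le_epsilon add_0 order.refl dense_ge)
  then show ?thesis by (simp add: f2_def)
qed

section \<open>Closure properties of smooth maps\<close>

lemma smooth_on_cong: "open S \<Longrightarrow> smooth_on S f \<Longrightarrow> (\<And>x. x \<in> S \<Longrightarrow> f x = g x) \<Longrightarrow> smooth_on S g"
  unfolding smooth_on_def using Ck_on_cong by blast

lemma smooth_on_subset: "smooth_on S f \<Longrightarrow> T \<subseteq> S \<Longrightarrow> smooth_on T f"
  unfolding smooth_on_def using Ck_on_subset by blast

lemma smooth_on_const: "smooth_on S (\<lambda>x. c)"
  unfolding smooth_on_def using Ck_on_const by blast

lemma smooth_on_linear: "open S \<Longrightarrow> bounded_linear f \<Longrightarrow> smooth_on S f"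
  unfolding smooth_on_def using Ck_on_linear by blast

lemma smooth_on_add: "open S \<Longrightarrow> smooth_on S f \<Longrightarrow> smooth_on S g \<Longrightarrow> smooth_on S (\<lambda>x. f x + g x)"
  unfolding smooth_on_def using Ck_on_add by blast

lemma smooth_on_scaleR:
  fixes f :: "'a::euclidean_space \<Rightarrow> real"
  shows "open S \<Longrightarrow> smooth_on S f \<Longrightarrow> smooth_on S g \<Longrightarrow> smooth_on S (\<lambda>x. f x *\<^sub>R g x)"
  unfolding smooth_on_def using Ck_on_scaleR by blast

lemma smooth_on_mult:
  fixes f :: "'a::euclidean_space \<Rightarrow> real"
  shows "open S \<Longrightarrow> smooth_on S f \<Longrightarrow> smooth_on S g \<Longrightarrow> smooth_on S (\<lambda>x. f x * g x)"
  unfolding smooth_on_def using Ck_on_mult by blast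

lemma smooth_on_inner_const: "open S \<Longrightarrow> smooth_on S f \<Longrightarrow> smooth_on S (\<lambda>x. f x \<bullet> b)"
  unfolding smooth_on_def using Ck_on_inner_const by blast

lemma smooth_on_compose:
  "open S \<Longrightarrow> open T \<Longrightarrow> g ` S \<subseteq> T \<Longrightarrow> smooth_on T f \<Longrightarrow> smooth_on S g \<Longrightarrow> smooth_on S (\<lambda>x. f (g x))"
  unfolding smooth_on_def using Ck_on_compose by blast

lemma smooth_on_derivative_along:
  "open S \<Longrightarrow> smooth_on S f \<Longrightarrow> smooth_on S g \<Longrightarrow> smooth_on S (\<lambda>x. frechet_derivative f (at x) (g x))"
  unfolding smooth_on_def using Ck_on_derivative_along by blast

lemma smooth_on_local:
  assumes "\<And>x. x \<in> S \<Longrightarrow> \<exists>T. open T \<and> x \<in> T \<and> smooth_on T f"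
  shows "smooth_on S f"
  unfolding smooth_on_def using assms smooth_on_def by (metis Ck_on_local)

lemma smooth_on_has_derivative:
  "smooth_on S f \<Longrightarrow> x \<in> S \<Longrightarrow> (f has_derivative frechet_derivative f (at x)) (at x)"
  unfolding smooth_on_def using Ck_on_has_derivative by blast

section \<open>Charts, functions and vector fields\<close>

text \<open>The differential at \<open>q\<close> of the change from chart \<open>c\<close> to chart
  \<open>d\<close>. \<open>tangent_coord\<close> is the case of the first chart being
  \<open>chart_at A q\<close>; leaving both charts free gives a cocycle rule,
  \<open>chart_diff_comp\<close>.\<close>

definition chart_diff :: "('a, 'e::euclidean_space) chart \<Rightarrow> ('a, 'e) chart \<Rightarrow> 'a \<Rightarrow> 'e \<Rightarrow> 'e" where
  "chart_diff c d q = frechet_derivative (cmap d \<circ> cinv c) (at (cmap c q))"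

locale smooth_manifold =
  fixes A :: "('a::{t2_space,second_countable_topology}, 'e::euclidean_space) chart set"
  assumes atlas: "smooth_atlas A"
begin

lemma chart_at: "chart_at A p \<in> A" "p \<in> cdom (chart_at A p)"
proof -
  have "\<exists>c. c \<in> A \<and> p \<in> cdom c"
    using atlas unfolding smooth_atlas_def by blast
  from someI_ex[OF this] show "chart_at A p \<in> A" "p \<in> cdom (chart_at A p)"
    unfolding chart_at_def by blast+
qed

lemma is_chart: "c \<in> A \<Longrightarrow> is_chart c"
  using atlas unfolding smooth_atlas_def by blast

lemma open_cdom: "c \<in> A \<Longrightarrow> open (cdom c)"
  and open_cmap_image: "c \<in> A \<Longrightarrow> open (cmap c ` cdom c)"
  and homeomorphism_chart: "c \<in> A \<Longrightarrow> homeomorphism (cdom c) (cmap c ` cdom c) (cmap c) (cinv c)"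
  using is_chart unfolding is_chart_def by blast+

lemma cinv_cmap: "c \<in> A \<Longrightarrow> q \<in> cdom c \<Longrightarrow> cinv c (cmap c q) = q"
  using homeomorphism_chart homeomorphism_apply1 by blast

lemma open_cmap:
  assumes "c \<in> A" "open W"
  shows "open (cmap c ` (cdom c \<inter> W))"
proof -
  have "openin (top_of_set (cdom c)) (cdom c \<inter> W)"
    using assms(2) by (simp add: openin_open_Int)
  from homeomorphism_imp_open_map[OF homeomorphism_chart[OF assms(1)] this]
  show ?thesis using open_cmap_image[OF assms(1)] openin_open_eq by blast
qed

lemma smooth_on_transition:
  assumes "c \<in> A" "d \<in> A"
  shows "smooth_on (cmap c ` (cdom c \<inter> cdom d)) (cmap d \<circ> cinv c)"
  using atlas assms unfolding smooth_atlas_def by blast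

lemma chart_diff_has_derivative:
  assumes "c \<in> A" "d \<in> A" "q \<in> cdom c" "q \<in> cdom d"
  shows "((cmap d \<circ> cinv c) has_derivative chart_diff c d q) (at (cmap c q))"
  unfolding chart_diff_def
  using smooth_on_has_derivative[OF smooth_on_transition[OF assms(1,2)]] assms by blast

text \<open>The chain rule through the transition map, for one object with expression
  \<open>F\<close> in chart \<open>d\<close> and \<open>G\<close> in chart \<open>c\<close>. The
  cocycle rule and the chart independence of \<open>deriv_along\<close> are both instances.\<close>

lemma frechet_derivative_chart_change:
  assumes "c \<in> A" "d \<in> A" "q \<in> cdom c" "q \<in> cdom d"
    and F: "F differentiable at (cmap d q)"
    and W: "open W" "q \<in> W" "\<And>r. r \<in> cdom c \<Longrightarrow> r \<in> cdom d \<Longrightarrow> r \<in> W \<Longrightarrow> G (cmap c r) = F (cmap d r)"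
  shows "(G has_derivative (\<lambda>v. frechet_derivative F (at (cmap d q)) (chart_diff c d q v))) (at (cmap c q))"
proof -
  let ?t = "cmap d \<circ> cinv c"
  have t: "?t (cmap c q) = cmap d q"
    using assms by (simp add: cinv_cmap)
  have "(F has_derivative frechet_derivative F (at (cmap d q))) (at (?t (cmap c q)))"
    using F unfolding t frechet_derivative_works .
  from has_derivative_compose[OF chart_diff_has_derivative[OF assms(1-4)] this]
  have "((\<lambda>u. F (?t u)) has_derivative (\<lambda>v. frechet_derivative F (at (cmap d q)) (chart_diff c d q v))) (at (cmap c q))" .
  then show ?thesis
  proof (rule has_derivative_transform_within_open)
    show "open (cmap c ` (cdom c \<inter> (cdom d \<inter> W)))"
      using assms W open_cdom by (intro open_cmap open_Int)
    show "cmap c q \<in> cmap c ` (cdom c \<inter> (cdom d \<inter> W))" using assms W by blast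
    show "F (?t u) = G u" if "u \<in> cmap c ` (cdom c \<inter> (cdom d \<inter> W))" for u
      using that W assms by (auto simp: cinv_cmap)
  qed
qed

lemma chart_diff_comp:
  assumes "c \<in> A" "d \<in> A" "e \<in> A" "q \<in> cdom c" "q \<in> cdom d" "q \<in> cdom e"
  shows "chart_diff d e q (chart_diff c d q v) = chart_diff c e q v"
proof -
  have "((cmap e \<circ> cinv c) has_derivative (\<lambda>v. chart_diff d e q (chart_diff c d q v))) (at (cmap c q))"
    unfolding chart_diff_def[of d e]
    by (rule frechet_derivative_chart_change[where W = UNIV])
      (use assms chart_diff_has_derivative[OF assms(2,3,5,6)] in \<open>auto simp: differentiable_def cinv_cmap\<close>)
  from has_derivative_unique[OF this chart_diff_has_derivative[OF assms(1,3,4,6)]]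
  show ?thesis by (rule fun_cong)
qed

lemma chart_diff_self:
  assumes "c \<in> A" "q \<in> cdom c"
  shows "chart_diff c c q v = v"
proof -
  have "((cmap c \<circ> cinv c) has_derivative (\<lambda>v. v)) (at (cmap c q))"
    by (rule has_derivative_transform_within_open[OF has_derivative_ident open_cmap_image[OF assms(1)]])
      (use assms in \<open>auto simp: cinv_cmap\<close>)
  from has_derivative_unique[OF chart_diff_has_derivative[OF assms(1,1,2,2)] this]
  show ?thesis by (rule fun_cong)
qed

lemma linear_chart_diff:
  assumes "c \<in> A" "d \<in> A" "q \<in> cdom c" "q \<in> cdom d"
  shows "linear (chart_diff c d q)"
  using chart_diff_has_derivative[OF assms] has_derivative_linear by blast

lemma tangent_coord_eq: "tangent_coord A c q v = chart_diff (chart_at A q) c q v"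
  by (simp add: tangent_coord_def chart_diff_def)

lemma linear_tangent_coord: "c \<in> A \<Longrightarrow> q \<in> cdom c \<Longrightarrow> linear (tangent_coord A c q)"
  unfolding tangent_coord_eq[abs_def] by (intro linear_chart_diff chart_at)

lemma tangent_coord_chart_at: "tangent_coord A (chart_at A q) q v = v"
  by (simp add: tangent_coord_eq chart_diff_self chart_at)

lemma tangent_coord_chart_diff:
  "c \<in> A \<Longrightarrow> d \<in> A \<Longrightarrow> q \<in> cdom c \<Longrightarrow> q \<in> cdom d \<Longrightarrow>
    tangent_coord A d q (chart_diff c (chart_at A q) q v) = chart_diff c d q v"
  by (simp add: tangent_coord_eq chart_diff_comp chart_at)

lemma chart_diff_tangent_coord:
  "c \<in> A \<Longrightarrow> q \<in> cdom c \<Longrightarrow> chart_diff c (chart_at A q) q (tangent_coord A c q v) = v"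
  by (simp add: tangent_coord_eq chart_diff_comp chart_diff_self chart_at)

lemma field_coord_cmap:
  "c \<in> A \<Longrightarrow> q \<in> cdom c \<Longrightarrow> field_coord A c X (cmap c q) = tangent_coord A c q (X q)"
  by (simp add: field_coord_def cinv_cmap)

section \<open>Derivations and the algebra of vector fields\<close>

lemma smooth_fun_has_derivative:
  assumes "smooth_fun A f" "c \<in> A" "q \<in> cdom c"
  shows "((f \<circ> cinv c) has_derivative frechet_derivative (f \<circ> cinv c) (at (cmap c q))) (at (cmap c q))"
  using assms smooth_on_has_derivative unfolding smooth_fun_def by blast

lemma deriv_along_has_derivative:
  assumes "smooth_fun A f"
  shows "((f \<circ> cinv (chart_at A p)) has_derivative (\<lambda>v. deriv_along A (\<lambda>_. v) f p)) (at (cmap (chart_at A p) p))"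
  using smooth_fun_has_derivative[OF assms chart_at(1,2)] unfolding deriv_along_def .

text \<open>\<open>deriv_along\<close> uses a different chart at every point. Reading it in one
  fixed chart is what makes its smoothness, and its further differentiation, accessible.\<close>

lemma deriv_along_chart:
  assumes "smooth_fun A f" "c \<in> A" "q \<in> cdom c"
  shows "deriv_along A X f q = frechet_derivative (f \<circ> cinv c) (at (cmap c q)) (tangent_coord A c q (X q))"
proof -
  have "((f \<circ> cinv (chart_at A q)) has_derivative
     (\<lambda>v. frechet_derivative (f \<circ> cinv c) (at (cmap c q)) (chart_diff (chart_at A q) c q v)))
     (at (cmap (chart_at A q) q))"
    by (rule frechet_derivative_chart_change[where W = UNIV])
      (use assms chart_at smooth_fun_has_derivative[OF assms] in \<open>auto simp: differentiable_def cinv_cmap\<close>)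
  from frechet_derivative_at[OF this, symmetric] show ?thesis
    by (simp add: deriv_along_def tangent_coord_eq)
qed

lemma vector_field_has_derivative:
  assumes "vector_field A X" "c \<in> A" "q \<in> cdom c"
  shows "(field_coord A c X has_derivative frechet_derivative (field_coord A c X) (at (cmap c q))) (at (cmap c q))"
  using assms smooth_on_has_derivative unfolding vector_field_def by blast

lemma vector_field_add:
  assumes "vector_field A X" "vector_field A Y"
  shows "vector_field A (\<lambda>q. X q + Y q)"
  unfolding vector_field_def
proof
  fix c assume c: "c \<in> A"
  have "smooth_on (cmap c ` cdom c) (\<lambda>u. field_coord A c X u + field_coord A c Y u)"
    using assms c open_cmap_image unfolding vector_field_def by (intro smooth_on_add) auto
  then show "smooth_on (cmap c ` cdom c) (field_coord A c (\<lambda>q. X q + Y q))"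
  proof (rule smooth_on_cong[OF open_cmap_image[OF c]])
    show "field_coord A c X u + field_coord A c Y u = field_coord A c (\<lambda>q. X q + Y q) u" if "u \<in> cmap c ` cdom c" for u
      using that c by (auto simp: field_coord_cmap linear_add[OF linear_tangent_coord])
  qed
qed

lemma vector_field_scaleR:
  assumes "smooth_fun A f" "vector_field A X"
  shows "vector_field A (\<lambda>q. f q *\<^sub>R X q)"
  unfolding vector_field_def
proof
  fix c assume c: "c \<in> A"
  have "smooth_on (cmap c ` cdom c) (\<lambda>u. (f \<circ> cinv c) u *\<^sub>R field_coord A c X u)"
    using assms c open_cmap_image unfolding vector_field_def smooth_fun_def by (intro smooth_on_scaleR) blast+
  then show "smooth_on (cmap c ` cdom c) (field_coord A c (\<lambda>q. f q *\<^sub>R X q))"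
  proof (rule smooth_on_cong[OF open_cmap_image[OF c]])
    show "(f \<circ> cinv c) u *\<^sub>R field_coord A c X u = field_coord A c (\<lambda>q. f q *\<^sub>R X q) u" if "u \<in> cmap c ` cdom c" for u
      using that c by (auto simp: field_coord_cmap linear_scale[OF linear_tangent_coord] cinv_cmap)
  qed
qed

lemma smooth_fun_const: "smooth_fun A (\<lambda>q. a)"
  by (simp add: smooth_fun_def comp_def smooth_on_const)

lemma smooth_fun_mult: "smooth_fun A f \<Longrightarrow> smooth_fun A g \<Longrightarrow> smooth_fun A (\<lambda>q. f q * g q)"
  unfolding smooth_fun_def comp_def by (simp add: smooth_on_mult open_cmap_image)

lemma vector_field_cmult: "vector_field A X \<Longrightarrow> vector_field A (\<lambda>q. a *\<^sub>R X q)"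
  using vector_field_scaleR[OF smooth_fun_const] .

lemma vector_field_minus: "vector_field A X \<Longrightarrow> vector_field A (\<lambda>q. - X q)"
  using vector_field_cmult[of X "- 1"] by simp

lemma vector_field_diff: "vector_field A X \<Longrightarrow> vector_field A Y \<Longrightarrow> vector_field A (\<lambda>q. X q - Y q)"
  using vector_field_add[OF _ vector_field_minus, of X Y] by simp

lemma smooth_fun_deriv_along:
  assumes "vector_field A X" "smooth_fun A f"
  shows "smooth_fun A (deriv_along A X f)"
  unfolding smooth_fun_def
proof
  fix c assume c: "c \<in> A"
  have "smooth_on (cmap c ` cdom c) (\<lambda>u. frechet_derivative (f \<circ> cinv c) (at u) (field_coord A c X u))"
    using assms c open_cmap_image unfolding vector_field_def smooth_fun_def
    by (intro smooth_on_derivative_along) auto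
  then show "smooth_on (cmap c ` cdom c) (deriv_along A X f \<circ> cinv c)"
  proof (rule smooth_on_cong[OF open_cmap_image[OF c]])
    show "frechet_derivative (f \<circ> cinv c) (at u) (field_coord A c X u) = (deriv_along A X f \<circ> cinv c) u" if "u \<in> cmap c ` cdom c" for u
      using that c by (auto simp: field_coord_cmap cinv_cmap deriv_along_chart[OF assms(2) c])
  qed
qed

lemma deriv_along_eqI:
  assumes "((f \<circ> cinv (chart_at A p)) has_derivative f') (at (cmap (chart_at A p) p))"
  shows "deriv_along A X f p = f' (X p)"
  unfolding deriv_along_def using frechet_derivative_at[OF assms] by simp

lemma deriv_along_const: "deriv_along A X (\<lambda>q. a) p = 0"
  by (rule deriv_along_eqI) (simp add: comp_def)

lemma deriv_along_add_fun:
  assumes "smooth_fun A f" "smooth_fun A g"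
  shows "deriv_along A X (\<lambda>q. f q + g q) p = deriv_along A X f p + deriv_along A X g p"
proof -
  let ?c = "chart_at A p"
  have "((\<lambda>u. (f \<circ> cinv ?c) u + (g \<circ> cinv ?c) u) has_derivative
     (\<lambda>v. deriv_along A (\<lambda>_. v) f p + deriv_along A (\<lambda>_. v) g p)) (at (cmap ?c p))"
    by (rule has_derivative_add) (rule assms[THEN deriv_along_has_derivative])+
  then have "(((\<lambda>q. f q + g q) \<circ> cinv ?c) has_derivative
     (\<lambda>v. deriv_along A (\<lambda>_. v) f p + deriv_along A (\<lambda>_. v) g p)) (at (cmap ?c p))"
    by (simp add: comp_def)
  from deriv_along_eqI[OF this] show ?thesis by (simp add: deriv_along_def)
qed

lemma deriv_along_mult_fun:
  assumes "smooth_fun A f" "smooth_fun A g"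
  shows "deriv_along A X (\<lambda>q. f q * g q) p = f p * deriv_along A X g p + deriv_along A X f p * g p"
proof -
  let ?c = "chart_at A p"
  have "((\<lambda>u. (f \<circ> cinv ?c) u * (g \<circ> cinv ?c) u) has_derivative
     (\<lambda>v. (f \<circ> cinv ?c) (cmap ?c p) * deriv_along A (\<lambda>_. v) g p + deriv_along A (\<lambda>_. v) f p * (g \<circ> cinv ?c) (cmap ?c p)))
     (at (cmap ?c p))"
    by (rule has_derivative_mult) (rule assms[THEN deriv_along_has_derivative])+
  then have "(((\<lambda>q. f q * g q) \<circ> cinv ?c) has_derivative
     (\<lambda>v. f p * deriv_along A (\<lambda>_. v) g p + deriv_along A (\<lambda>_. v) f p * g p)) (at (cmap ?c p))"
    by (simp add: comp_def cinv_cmap chart_at)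
  from deriv_along_eqI[OF this] show ?thesis by (simp add: deriv_along_def)
qed

lemma linear_deriv_along: "smooth_fun A f \<Longrightarrow> linear (\<lambda>v. deriv_along A (\<lambda>_. v) f p)"
  using deriv_along_has_derivative has_derivative_linear by blast

text \<open>In coordinates XYf is a Hessian term plus the derivative of f along the directional
  derivative of Y. The Hessian terms of XYf and YXf agree by symmetry, and what remains is the
  coordinate formula of the bracket.\<close>

lemma deriv_along_lie_bracket:
  assumes X: "vector_field A X" and Y: "vector_field A Y" and f: "smooth_fun A f"
  shows "deriv_along A (lie_bracket A X Y) f p =
    deriv_along A X (deriv_along A Y f) p - deriv_along A Y (deriv_along A X f) p"
proof -
  define c where "c = chart_at A p"
  define u where "u = cmap c p"
  define F where "F = f \<circ> cinv c"
  let ?S = "cmap c ` cdom c"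
  have c: "c \<in> A" "p \<in> cdom c" by (simp_all add: c_def chart_at)
  have uS: "u \<in> ?S" using c by (simp add: u_def)
  have S: "open ?S" using open_cmap_image c by blast
  have F: "smooth_on ?S F" using f c unfolding F_def smooth_fun_def by blast
  have F': "linear (frechet_derivative F (at u))"
    using smooth_on_has_derivative[OF F uS] has_derivative_linear by blast
  have "Ck_on (Suc (Suc 0)) ?S F" using F unfolding smooth_on_def by blast
  note commute = frechet_derivative_commute[OF S uS this]
  have F'': "linear (frechet_derivative (\<lambda>y. frechet_derivative F (at y) b) (at u))" for b
    using smooth_on_has_derivative[OF smooth_on_derivative_along[OF S F smooth_on_const] uS] has_derivative_linear by blast
  have second: "deriv_along A X (deriv_along A Y f) p =
      frechet_derivative (\<lambda>y. frechet_derivative F (at y) (Y p)) (at u) (X p) +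
      frechet_derivative F (at u) (frechet_derivative (field_coord A c Y) (at u) (X p))"
    if X: "vector_field A X" and Y: "vector_field A Y" for X Y
  proof -
    let ?Y = "field_coord A c Y"
    have Yp: "?Y u = Y p" using c by (simp add: u_def field_coord_cmap) (simp add: c_def tangent_coord_chart_at)
    have "((\<lambda>y. frechet_derivative F (at y) b) has_derivative
        frechet_derivative (\<lambda>y. frechet_derivative F (at y) b) (at u)) (at u)" for b
      using smooth_on_has_derivative[OF smooth_on_derivative_along[OF S F smooth_on_const] uS] .
    moreover have dY: "(?Y has_derivative frechet_derivative ?Y (at u)) (at u)"
      using vector_field_has_derivative[OF Y c] by (simp add: u_def)
    ultimately have "((\<lambda>y. \<Sum>b\<in>Basis. (?Y y \<bullet> b) *\<^sub>R frechet_derivative F (at y) b) has_derivative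
       (\<lambda>v. \<Sum>b\<in>Basis. (?Y u \<bullet> b) *\<^sub>R frechet_derivative (\<lambda>y. frechet_derivative F (at y) b) (at u) v
          + (frechet_derivative ?Y (at u) v \<bullet> b) *\<^sub>R frechet_derivative F (at u) b)) (at u)"
      by (intro has_derivative_sum has_derivative_scaleR has_derivative_inner_left)
    then have "((deriv_along A Y f \<circ> cinv c) has_derivative
       (\<lambda>v. \<Sum>b\<in>Basis. (?Y u \<bullet> b) *\<^sub>R frechet_derivative (\<lambda>y. frechet_derivative F (at y) b) (at u) v
          + (frechet_derivative ?Y (at u) v \<bullet> b) *\<^sub>R frechet_derivative F (at u) b)) (at u)"
    proof (rule has_derivative_transform_within_open[OF _ S uS])
      fix y assume y: "y \<in> ?S"
      have "linear (frechet_derivative F (at y))"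
        using smooth_on_has_derivative[OF F y] has_derivative_linear by blast
      from linear_basis_expansion[OF this, of "?Y y", symmetric]
      show "(\<Sum>b\<in>Basis. (?Y y \<bullet> b) *\<^sub>R frechet_derivative F (at y) b) = (deriv_along A Y f \<circ> cinv c) y"
        using y c by (auto simp: F_def field_coord_cmap cinv_cmap deriv_along_chart[OF f c(1)])
    qed
    from deriv_along_eqI[OF this[unfolded u_def c_def], folded c_def, folded u_def]
    have "deriv_along A X (deriv_along A Y f) p =
        (\<Sum>b\<in>Basis. (Y p \<bullet> b) *\<^sub>R frechet_derivative (\<lambda>y. frechet_derivative F (at y) b) (at u) (X p))
      + (\<Sum>b\<in>Basis. (frechet_derivative ?Y (at u) (X p) \<bullet> b) *\<^sub>R frechet_derivative F (at u) b)"
      by (simp add: sum.distrib Yp)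
    also have "(\<Sum>b\<in>Basis. (frechet_derivative ?Y (at u) (X p) \<bullet> b) *\<^sub>R frechet_derivative F (at u) b)
      = frechet_derivative F (at u) (frechet_derivative ?Y (at u) (X p))"
      by (rule linear_basis_expansion[OF F', symmetric])
    \<comment> \<open>The sum over \<open>Basis\<close> can be collected only in the direction of
      the outer derivative, whose linearity is \<open>F''\<close>. So the two directions are
      exchanged, the sum is collected, and the exchange is undone.\<close>
    also have "(\<Sum>b\<in>Basis. (Y p \<bullet> b) *\<^sub>R frechet_derivative (\<lambda>y. frechet_derivative F (at y) b) (at u) (X p))
      = (\<Sum>b\<in>Basis. (Y p \<bullet> b) *\<^sub>R frechet_derivative (\<lambda>y. frechet_derivative F (at y) (X p)) (at u) b)"
      by (simp only: commute[of _ "X p"])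
    also have "\<dots> = frechet_derivative (\<lambda>y. frechet_derivative F (at y) (X p)) (at u) (Y p)"
      by (rule linear_basis_expansion[OF F'', symmetric])
    also have "\<dots> = frechet_derivative (\<lambda>y. frechet_derivative F (at y) (Y p)) (at u) (X p)"
      by (rule commute)
    finally show ?thesis .
  qed
  have "frechet_derivative (\<lambda>y. frechet_derivative F (at y) (X p)) (at u) (Y p)
      = frechet_derivative (\<lambda>y. frechet_derivative F (at y) (Y p)) (at u) (X p)"
    by (rule commute)
  moreover have "deriv_along A (lie_bracket A X Y) f p = frechet_derivative F (at u)
     (frechet_derivative (field_coord A c Y) (at u) (X p) - frechet_derivative (field_coord A c X) (at u) (Y p))"
    unfolding deriv_along_def lie_bracket_def by (simp add: F_def u_def c_def Let_def)
  ultimately show ?thesis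
    by (simp add: second X Y linear_diff[OF F'])
qed

end

section \<open>Extension by bump functions and tensoriality\<close>

context smooth_manifold
begin

text \<open>Compactness of \<open>K\<close> together with the Hausdorff property makes its preimage
  closed in the whole manifold, not merely in \<open>cdom c\<close>. Hence \<open>cdom c\<close> and
  the complement of that preimage are open sets covering everything, and smoothness is checked on
  each.\<close>

lemma smooth_on_zero_extension:
  fixes h :: "'a \<Rightarrow> 'v::euclidean_space"
  assumes c: "c \<in> A" and d: "d \<in> A" and K: "compact K" "K \<subseteq> cmap c ` cdom c"
    and H: "smooth_on (cmap c ` (cdom c \<inter> cdom d)) H"
    and inside: "\<And>q. q \<in> cdom c \<Longrightarrow> q \<in> cdom d \<Longrightarrow> h q = H (cmap c q)"
    and outside: "\<And>q. q \<in> cdom d \<Longrightarrow> \<not> (q \<in> cdom c \<and> cmap c q \<in> K) \<Longrightarrow> h q = 0"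
  shows "smooth_on (cmap d ` cdom d) (\<lambda>u. h (cinv d u))"
proof (rule smooth_on_local)
  fix u assume "u \<in> cmap d ` cdom d"
  then obtain q where q: "q \<in> cdom d" "u = cmap d q" by blast
  have "compact (cinv c ` K)"
    using homeomorphism_chart[OF c] K
    by (intro compact_continuous_image) (auto simp: homeomorphism_def intro: continuous_on_subset)
  then have closed: "closed (cinv c ` K)" by (rule compact_imp_closed)
  show "\<exists>T. open T \<and> u \<in> T \<and> smooth_on T (\<lambda>u. h (cinv d u))"
  proof (cases "q \<in> cdom c")
    case True
    let ?T = "cmap d ` (cdom d \<inter> cdom c)" and ?U = "cmap c ` (cdom c \<inter> cdom d)"
    have op: "open ?T" "open ?U" using open_cmap open_cdom c d by blast+
    have "(cmap c \<circ> cinv d) ` ?T \<subseteq> ?U"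
      using d by (auto simp: cinv_cmap)
    then have "smooth_on ?T (\<lambda>u. H ((cmap c \<circ> cinv d) u))"
      by (rule smooth_on_compose[OF op _ H smooth_on_transition[OF d c]])
    then have "smooth_on ?T (\<lambda>u. h (cinv d u))"
      by (rule smooth_on_cong[OF op(1)]) (use d in \<open>auto simp: cinv_cmap inside\<close>)
    then show ?thesis using op q True by blast
  next
    case False
    let ?T = "cmap d ` (cdom d \<inter> - cinv c ` K)"
    have op: "open ?T" using open_cmap[OF d] closed by blast
    have "smooth_on ?T (\<lambda>u. 0 :: 'v)" by (rule smooth_on_const)
    then have "smooth_on ?T (\<lambda>u. h (cinv d u))"
    proof (rule smooth_on_cong[OF op])
      fix u assume "u \<in> ?T"
      then obtain r where r: "r \<in> cdom d" "r \<notin> cinv c ` K" "u = cmap d r" by blast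
      then have "\<not> (r \<in> cdom c \<and> cmap c r \<in> K)"
        using cinv_cmap[OF c, of r] image_eqI[of r "cinv c" "cmap c r" K] by auto
      with outside r d show "0 = h (cinv d u)" by (simp add: cinv_cmap)
    qed
    moreover have "q \<notin> cinv c ` K"
    proof
      assume "q \<in> cinv c ` K"
      then obtain x where "x \<in> K" "q = cinv c x" by blast
      then show False using K(2) False inv_into_into[of x "cmap c" "cdom c"] by blast
    qed
    ultimately show ?thesis using op q by blast
  qed
qed

definition extend_fun :: "('e \<Rightarrow> real) \<Rightarrow> ('a, 'e) chart \<Rightarrow> ('e \<Rightarrow> real) \<Rightarrow> 'a \<Rightarrow> real" where
  "extend_fun \<eta> c F q = (if q \<in> cdom c then \<eta> (cmap c q) * F (cmap c q) else 0)"

text \<open>A constant coordinate field of chart \<open>c\<close>, cut off by the bump. The factor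
  \<open>chart_diff\<close> rewrites \<open>b\<close> in \<open>chart_at A q\<close>, since values
  of fields are always expressed in that chart.\<close>

definition extend_const :: "('e \<Rightarrow> real) \<Rightarrow> ('a, 'e) chart \<Rightarrow> 'e \<Rightarrow> 'a \<Rightarrow> 'e" where
  "extend_const \<eta> c b q = (if q \<in> cdom c then \<eta> (cmap c q) *\<^sub>R chart_diff c (chart_at A q) q b else 0)"

lemma smooth_fun_extend_fun:
  assumes c: "c \<in> A" and K: "compact K" "K \<subseteq> cmap c ` cdom c"
    and \<eta>: "smooth_on UNIV \<eta>" "\<forall>x. x \<notin> K \<longrightarrow> \<eta> x = 0"
    and F: "smooth_on (cmap c ` cdom c) F"
  shows "smooth_fun A (extend_fun \<eta> c F)"
  unfolding smooth_fun_def comp_def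
proof
  fix d assume d: "d \<in> A"
  let ?U = "cmap c ` (cdom c \<inter> cdom d)"
  have op: "open ?U" using open_cmap open_cdom c d by blast
  have "smooth_on ?U (\<lambda>y. \<eta> y * F y)"
    by (intro smooth_on_mult op smooth_on_subset[OF \<eta>(1)] smooth_on_subset[OF F]) auto
  then show "smooth_on (cmap d ` cdom d) (\<lambda>x. extend_fun \<eta> c F (cinv d x))"
    by (rule smooth_on_zero_extension[OF c d K]) (use \<eta>(2) in \<open>auto simp: extend_fun_def\<close>)
qed

lemma vector_field_extend_const:
  assumes c: "c \<in> A" and K: "compact K" "K \<subseteq> cmap c ` cdom c"
    and \<eta>: "smooth_on UNIV \<eta>" "\<forall>x. x \<notin> K \<longrightarrow> \<eta> x = 0"
  shows "vector_field A (extend_const \<eta> c b)"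
  unfolding vector_field_def
proof
  fix d assume d: "d \<in> A"
  let ?U = "cmap c ` (cdom c \<inter> cdom d)"
  let ?H = "\<lambda>y. \<eta> y *\<^sub>R frechet_derivative (cmap d \<circ> cinv c) (at y) b"
  have op: "open ?U" using open_cmap open_cdom c d by blast
  have "smooth_on ?U ?H"
    by (intro smooth_on_scaleR op smooth_on_subset[OF \<eta>(1)] smooth_on_derivative_along
        smooth_on_transition[OF c d] smooth_on_const) auto
  then show "smooth_on (cmap d ` cdom d) (field_coord A d (extend_const \<eta> c b))"
    unfolding field_coord_def[abs_def]
  proof (rule smooth_on_zero_extension[OF c d K])
    fix q assume q: "q \<in> cdom c" "q \<in> cdom d"
    then show "tangent_coord A d q (extend_const \<eta> c b q) = ?H (cmap c q)"
      using c d by (simp add: extend_const_def linear_scale[OF linear_tangent_coord]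
          tangent_coord_chart_diff) (simp add: chart_diff_def)
  next
    fix q assume q: "q \<in> cdom d" "\<not> (q \<in> cdom c \<and> cmap c q \<in> K)"
    then show "tangent_coord A d q (extend_const \<eta> c b q) = 0"
      using d \<eta>(2) by (auto simp: extend_const_def linear_0[OF linear_tangent_coord])
  qed
qed

lemma bump_in_chart:
  obtains K \<eta> where "compact K" "K \<subseteq> cmap (chart_at A p) ` cdom (chart_at A p)"
    "smooth_on UNIV \<eta>" "\<forall>x. x \<notin> K \<longrightarrow> \<eta> x = 0" "\<eta> (cmap (chart_at A p) p) = (1::real)"
proof -
  let ?c = "chart_at A p"
  have "cmap ?c p \<in> cmap ?c ` cdom ?c" using chart_at by blast
  then obtain r where r: "r > 0" "cball (cmap ?c p) r \<subseteq> cmap ?c ` cdom ?c"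
    using open_cmap_image[OF chart_at(1)] open_contains_cball by metis
  obtain \<eta> :: "'e \<Rightarrow> real" where \<eta>: "smooth_on UNIV \<eta>" "\<eta> (cmap ?c p) = 1"
    "\<And>x. x \<notin> ball (cmap ?c p) r \<Longrightarrow> \<eta> x = 0"
    using smooth_bump_exists[OF r(1), of "cmap ?c p"] by blast
  show ?thesis
    by (rule that[OF compact_cball r(2) \<eta>(1) _ \<eta>(2)]) (use \<eta>(3) ball_subset_cball in blast)
qed

lemma vector_field_extends:
  obtains X where "vector_field A X" "X p = x"
proof -
  obtain K \<eta> where K: "compact K" "K \<subseteq> cmap (chart_at A p) ` cdom (chart_at A p)"
    "smooth_on UNIV \<eta>" "\<forall>x. x \<notin> K \<longrightarrow> \<eta> x = 0" "\<eta> (cmap (chart_at A p) p) = (1::real)"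
    using bump_in_chart by blast
  have "extend_const \<eta> (chart_at A p) x p = x"
    using K(5) by (simp add: extend_const_def chart_at chart_diff_self)
  then show ?thesis using that vector_field_extend_const[OF chart_at(1) K(1-4)] by blast
qed

text \<open>Reduces an identity between fields to one between derivations. The test functions are
  the coordinates of a chart, cut off to become global.\<close>

lemma deriv_along_separates:
  assumes "\<And>f. smooth_fun A f \<Longrightarrow> deriv_along A W f p = 0"
  shows "W p = 0"
proof -
  let ?c = "chart_at A p"
  obtain K \<eta> where K: "compact K" "K \<subseteq> cmap ?c ` cdom ?c"
    "smooth_on UNIV \<eta>" "\<forall>x. x \<notin> K \<longrightarrow> \<eta> x = 0" "\<eta> (cmap ?c p) = (1::real)"
    using bump_in_chart by blast
  let ?u = "cmap ?c p"
  have "W p \<bullet> b = 0" for b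
  proof -
    \<comment> \<open>Shifted so as to vanish at the base point: the derivative of the bump then
      drops out of the product rule.\<close>
    let ?F = "\<lambda>x. (x + (- ?u)) \<bullet> b"
    have "smooth_on (cmap ?c ` cdom ?c) ?F"
      by (intro smooth_on_inner_const smooth_on_add smooth_on_linear smooth_on_const
          open_cmap_image chart_at bounded_linear_ident)
    then have sm: "smooth_fun A (extend_fun \<eta> ?c ?F)"
      by (rule smooth_fun_extend_fun[OF chart_at(1) K(1-4)])
    have "(\<eta> has_derivative frechet_derivative \<eta> (at ?u)) (at ?u)"
      using smooth_on_has_derivative[OF K(3)] by blast
    moreover have "(?F has_derivative (\<lambda>v. v \<bullet> b)) (at ?u)"
      by (auto intro!: derivative_eq_intros)
    ultimately have "((\<lambda>x. \<eta> x * ?F x) has_derivative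
        (\<lambda>v. \<eta> ?u * (v \<bullet> b) + frechet_derivative \<eta> (at ?u) v * ?F ?u)) (at ?u)"
      by (rule has_derivative_mult)
    then have "((\<lambda>x. \<eta> x * ?F x) has_derivative (\<lambda>v. v \<bullet> b)) (at ?u)"
      by (simp add: K(5))
    then have "((extend_fun \<eta> ?c ?F \<circ> cinv ?c) has_derivative (\<lambda>v. v \<bullet> b)) (at ?u)"
      by (rule has_derivative_transform_within_open[OF _ open_cmap_image[OF chart_at(1)]])
        (auto simp: extend_fun_def cinv_cmap chart_at)
    from deriv_along_eqI[OF this, of W] show ?thesis using assms[OF sm] by simp
  qed
  then show ?thesis by (metis inner_eq_zero_iff)
qed

lemma vector_field_zero: "vector_field A (\<lambda>q. 0)"
proof -
  obtain X where "vector_field A X" using vector_field_extends by blast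
  from vector_field_cmult[OF this, of 0] show ?thesis by simp
qed

text \<open>The square of the bump function is needed: one factor makes the components of the field
  globally smooth, the other the coordinate fields.\<close>

lemma local_frame:
  obtains s E where "smooth_fun A s" "s p = 1" "\<And>b. vector_field A (E b)"
    "\<And>Z. vector_field A Z \<Longrightarrow> \<exists>\<zeta>. (\<forall>b. smooth_fun A (\<zeta> b)) \<and> (\<forall>b. \<zeta> b p = Z p \<bullet> b) \<and>
       (\<forall>q. s q *\<^sub>R (s q *\<^sub>R Z q) = (\<Sum>b\<in>Basis. \<zeta> b q *\<^sub>R E b q))"
proof -
  let ?c = "chart_at A p"
  obtain K \<eta> where K: "compact K" "K \<subseteq> cmap ?c ` cdom ?c"
    "smooth_on UNIV \<eta>" "\<forall>x. x \<notin> K \<longrightarrow> \<eta> x = 0" "\<eta> (cmap ?c p) = (1::real)"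
    using bump_in_chart by blast
  note c = chart_at[of p]
  show ?thesis
  proof (rule that)
    show "smooth_fun A (extend_fun \<eta> ?c (\<lambda>_. 1))"
      by (rule smooth_fun_extend_fun[OF c(1) K(1-4) smooth_on_const])
    show "extend_fun \<eta> ?c (\<lambda>_. 1) p = 1"
      using K(5) c by (simp add: extend_fun_def)
    show "vector_field A (extend_const \<eta> ?c b)" for b
      by (rule vector_field_extend_const[OF c(1) K(1-4)])
    fix Z assume Z: "vector_field A Z"
    let ?\<zeta> = "\<lambda>b. extend_fun \<eta> ?c (\<lambda>u. field_coord A ?c Z u \<bullet> b)"
    have sm: "smooth_fun A (?\<zeta> b)" for b
      by (rule smooth_fun_extend_fun[OF c(1) K(1-4)])
        (use Z c in \<open>auto intro!: smooth_on_inner_const open_cmap_image simp: vector_field_def\<close>)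
    have at_p: "?\<zeta> b p = Z p \<bullet> b" for b
      using c K(5) by (simp add: extend_fun_def field_coord_cmap tangent_coord_chart_at)
    have expand: "extend_fun \<eta> ?c (\<lambda>_. 1) q *\<^sub>R (extend_fun \<eta> ?c (\<lambda>_. 1) q *\<^sub>R Z q)
       = (\<Sum>b\<in>Basis. ?\<zeta> b q *\<^sub>R extend_const \<eta> ?c b q)" for q
    proof (cases "q \<in> cdom ?c")
      case True
      have lin: "linear (chart_diff ?c (chart_at A q) q)"
        using True c by (intro linear_chart_diff chart_at)
      have "(\<Sum>b\<in>Basis. ?\<zeta> b q *\<^sub>R extend_const \<eta> ?c b q) = 
         (\<eta> (cmap ?c q) * \<eta> (cmap ?c q)) *\<^sub>R
         (\<Sum>b\<in>Basis. (tangent_coord A ?c q (Z q) \<bullet> b) *\<^sub>R chart_diff ?c (chart_at A q) q b)"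
        using True c by (simp add: extend_fun_def extend_const_def field_coord_cmap scaleR_sum_right mult_ac)
      also have "\<dots> = (\<eta> (cmap ?c q) * \<eta> (cmap ?c q)) *\<^sub>R Z q"
        using True c by (simp add: chart_diff_tangent_coord flip: linear_basis_expansion[OF lin])
      finally show ?thesis using True by (simp add: extend_fun_def)
    qed (simp add: extend_fun_def)
    show "\<exists>\<zeta>. (\<forall>b. smooth_fun A (\<zeta> b)) \<and> (\<forall>b. \<zeta> b p = Z p \<bullet> b) \<and>
       (\<forall>q. extend_fun \<eta> ?c (\<lambda>_. 1) q *\<^sub>R (extend_fun \<eta> ?c (\<lambda>_. 1) q *\<^sub>R Z q)
         = (\<Sum>b\<in>Basis. \<zeta> b q *\<^sub>R extend_const \<eta> ?c b q))"
      by (intro exI[of _ ?\<zeta>] conjI allI sm at_p expand)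
  qed
qed

lemma vector_field_sum:
  assumes "\<And>i. i \<in> I \<Longrightarrow> vector_field A (X i)"
  shows "vector_field A (\<lambda>q. \<Sum>i\<in>I. X i q)"
  using assms by (induction I rule: infinite_finite_induct) (simp_all add: vector_field_zero vector_field_add)

text \<open>The cut-off \<open>s\<close> equals 1 at \<open>p\<close>, so multiplying a field by its
  square does not change the value of \<open>T\<close>. The product expands in globally defined
  fields with globally smooth coefficients, and only the coefficients at \<open>p\<close>
  survive.\<close>

lemma tensorial:
  fixes T :: "('a \<Rightarrow> 'e) \<Rightarrow> 'v::real_vector"
  assumes add: "\<And>X Y. vector_field A X \<Longrightarrow> vector_field A Y \<Longrightarrow> T (\<lambda>q. X q + Y q) = T X + T Y"
    and scale: "\<And>f X. smooth_fun A f \<Longrightarrow> vector_field A X \<Longrightarrow> T (\<lambda>q. f q *\<^sub>R X q) = f p *\<^sub>R T X"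
    and X: "vector_field A X" and Y: "vector_field A Y" and eq: "X p = Y p"
  shows "T X = T Y"
proof -
  obtain s E where s: "smooth_fun A s" "s p = 1" and E: "\<And>b. vector_field A (E b)"
    and frame: "\<And>Z. vector_field A Z \<Longrightarrow> \<exists>\<zeta>. (\<forall>b. smooth_fun A (\<zeta> b)) \<and> (\<forall>b. \<zeta> b p = Z p \<bullet> b) \<and>
       (\<forall>q. s q *\<^sub>R (s q *\<^sub>R Z q) = (\<Sum>b\<in>Basis. \<zeta> b q *\<^sub>R E b q))"
    using local_frame by blast
  have zero: "T (\<lambda>q. 0) = 0"
    using add[OF vector_field_zero vector_field_zero] by simp
  have sum: "T (\<lambda>q. \<Sum>i\<in>I. X i q) = (\<Sum>i\<in>I. T (X i))"
    if "\<And>i. i \<in> I \<Longrightarrow> vector_field A (X i)" for I :: "'e set" and X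
    using that
    by (induction I rule: infinite_finite_induct) (simp_all add: zero add vector_field_sum)
  have "T Z = (\<Sum>b\<in>Basis. (Z p \<bullet> b) *\<^sub>R T (E b))" if Z: "vector_field A Z" for Z
  proof -
    obtain \<zeta> where \<zeta>: "\<And>b. smooth_fun A (\<zeta> b)" "\<And>b. \<zeta> b p = Z p \<bullet> b"
      "\<And>q. s q *\<^sub>R (s q *\<^sub>R Z q) = (\<Sum>b\<in>Basis. \<zeta> b q *\<^sub>R E b q)"
      using frame[OF Z] by blast
    have "T Z = T (\<lambda>q. s q *\<^sub>R (s q *\<^sub>R Z q))"
      using s Z by (simp add: scale vector_field_scaleR del: scaleR_scaleR)
    also have "\<dots> = (\<Sum>b\<in>Basis. T (\<lambda>q. \<zeta> b q *\<^sub>R E b q))"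
      unfolding \<zeta>(3) by (rule sum) (intro vector_field_scaleR \<zeta>(1) E)
    also have "\<dots> = (\<Sum>b\<in>Basis. (Z p \<bullet> b) *\<^sub>R T (E b))"
      by (simp add: scale[OF \<zeta>(1) E] \<zeta>(2))
    finally show ?thesis .
  qed
  then show ?thesis using X Y eq by simp
qed

end

section \<open>Curvature of the Levi-Civita connection\<close>

locale almost_hermitian_manifold =
  fixes A :: "('a::{t2_space,second_countable_topology}, 'e::euclidean_space) chart set"
    and g :: "'a \<Rightarrow> 'e \<Rightarrow> 'e \<Rightarrow> real" and J :: "'a \<Rightarrow> 'e \<Rightarrow> 'e"
    and D :: "('a \<Rightarrow> 'e) \<Rightarrow> ('a \<Rightarrow> 'e) \<Rightarrow> 'a \<Rightarrow> 'e"
  assumes almost_hermitian: "almost_hermitian A g J" and levi_civita: "levi_civita A g D"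
begin

sublocale smooth_manifold A
  using almost_hermitian by unfold_locales (simp add: almost_hermitian_def)

lemma riemannian: "riemannian_metric A g" and almost_complex: "almost_complex A J"
  and g_J_J: "g p (J p x) (J p y) = g p x y"
  using almost_hermitian by (simp_all add: almost_hermitian_def)

lemma bilinear_g: "bilinear (g p)" and g_pos: "x \<noteq> 0 \<Longrightarrow> g p x x > 0"
  and smooth_fun_g: "vector_field A X \<Longrightarrow> vector_field A Y \<Longrightarrow> smooth_fun A (\<lambda>p. g p (X p) (Y p))"
  using riemannian by (simp_all add: riemannian_metric_def)

lemma g_commute: "g p x y = g p y x"
  using riemannian unfolding riemannian_metric_def by blast

lemma linear_J: "linear (J p)" and J_J: "J p (J p x) = - x"
  and vector_field_J: "vector_field A X \<Longrightarrow> vector_field A (\<lambda>p. J p (X p))"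
  using almost_complex by (simp_all add: almost_complex_def)

lemmas J_simps = linear_add[OF linear_J] linear_diff[OF linear_J] linear_neg[OF linear_J]
  linear_scale[OF linear_J] linear_0[OF linear_J] J_J

lemmas g_simps = bilinear_ladd[OF bilinear_g] bilinear_radd[OF bilinear_g]
  bilinear_lsub[OF bilinear_g] bilinear_rsub[OF bilinear_g]
  bilinear_lneg[OF bilinear_g] bilinear_rneg[OF bilinear_g]
  bilinear_lmul[OF bilinear_g] bilinear_rmul[OF bilinear_g]
  bilinear_lzero[OF bilinear_g] bilinear_rzero[OF bilinear_g]

lemma g_J_left: "g p (J p x) y = - g p x (J p y)"
  using g_J_J[of p x "J p y"] unfolding J_simps g_simps by linarith

lemma g_nondegenerate: "(\<And>w. g p x w = 0) \<Longrightarrow> x = 0"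
  using g_pos[of x p] by (metis less_irrefl)

lemma affine: "affine_connection A D"
  using levi_civita by (simp only: levi_civita_def)

lemmas vector_field_D = affine[unfolded affine_connection_def, THEN conjunct1, rule_format]

text \<open>This rule and the next ones are equations between fields rather than between values, so
  that they can rewrite inside an outer \<open>D\<close>, as curvature computations require.\<close>

lemma D_add_left: "vector_field A X \<Longrightarrow> vector_field A Y \<Longrightarrow> vector_field A Z \<Longrightarrow>
    D (\<lambda>q. X q + Y q) Z = (\<lambda>p. D X Z p + D Y Z p)"
  by (rule ext) (rule affine[unfolded affine_connection_def, THEN conjunct2, THEN conjunct1, THEN spec, THEN spec, THEN spec, THEN mp, THEN mp, THEN mp, THEN conjunct1, THEN spec])

lemma D_add_right: "vector_field A X \<Longrightarrow> vector_field A Y \<Longrightarrow> vector_field A Z \<Longrightarrow>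
    D X (\<lambda>q. Y q + Z q) = (\<lambda>p. D X Y p + D X Z p)"
  by (rule ext) (rule affine[unfolded affine_connection_def, THEN conjunct2, THEN conjunct1, THEN spec, THEN spec, THEN spec, THEN mp, THEN mp, THEN mp, THEN conjunct2, THEN spec])

lemma D_scale_left: "smooth_fun A f \<Longrightarrow> vector_field A X \<Longrightarrow> vector_field A Y \<Longrightarrow>
    D (\<lambda>q. f q *\<^sub>R X q) Y = (\<lambda>p. f p *\<^sub>R D X Y p)"
  by (rule ext) (rule affine[unfolded affine_connection_def, THEN conjunct2, THEN conjunct2, THEN spec, THEN spec, THEN spec, THEN mp, THEN mp, THEN mp, THEN conjunct1, THEN spec])

lemma D_scale_right: "smooth_fun A f \<Longrightarrow> vector_field A X \<Longrightarrow> vector_field A Y \<Longrightarrow>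
    D X (\<lambda>q. f q *\<^sub>R Y q) = (\<lambda>p. deriv_along A X f p *\<^sub>R Y p + f p *\<^sub>R D X Y p)"
  by (rule ext) (rule affine[unfolded affine_connection_def, THEN conjunct2, THEN conjunct2, THEN spec, THEN spec, THEN spec, THEN mp, THEN mp, THEN mp, THEN conjunct2, THEN spec])

lemma lie_bracket_D: "vector_field A X \<Longrightarrow> vector_field A Y \<Longrightarrow>
    lie_bracket A X Y = (\<lambda>p. D X Y p - D Y X p)"
  by (rule ext) (rule levi_civita[unfolded levi_civita_def, THEN conjunct2, THEN conjunct1, THEN spec, THEN spec, THEN mp, THEN mp, THEN spec, symmetric])

lemma deriv_along_g: "vector_field A X \<Longrightarrow> vector_field A Y \<Longrightarrow> vector_field A Z \<Longrightarrow>
    deriv_along A X (\<lambda>q. g q (Y q) (Z q)) = (\<lambda>p. g p (D X Y p) (Z p) + g p (Y p) (D X Z p))"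
  by (rule ext) (rule levi_civita[unfolded levi_civita_def, THEN conjunct2, THEN conjunct2, THEN spec, THEN spec, THEN spec, THEN mp, THEN mp, THEN mp, THEN spec])

lemma D_minus_left: "vector_field A X \<Longrightarrow> vector_field A Y \<Longrightarrow> D (\<lambda>q. - X q) Y = (\<lambda>p. - D X Y p)"
  using D_scale_left[OF smooth_fun_const, of X Y "- 1"] by simp

lemma D_minus_right: "vector_field A X \<Longrightarrow> vector_field A Y \<Longrightarrow> D X (\<lambda>q. - Y q) = (\<lambda>p. - D X Y p)"
  using D_scale_right[OF smooth_fun_const, of X Y "- 1"] by (simp add: deriv_along_const)

lemma D_diff_left: "vector_field A X \<Longrightarrow> vector_field A Y \<Longrightarrow> vector_field A Z \<Longrightarrow>
    D (\<lambda>q. X q - Y q) Z = (\<lambda>p. D X Z p - D Y Z p)"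
  using D_add_left[OF _ vector_field_minus, of X Y Z] by (simp add: D_minus_left)

lemma D_diff_right: "vector_field A X \<Longrightarrow> vector_field A Y \<Longrightarrow> vector_field A Z \<Longrightarrow>
    D X (\<lambda>q. Y q - Z q) = (\<lambda>p. D X Y p - D X Z p)"
  using D_add_right[OF _ _ vector_field_minus, of X Y Z] by (simp add: D_minus_right)

lemma vector_field_lie_bracket: "vector_field A X \<Longrightarrow> vector_field A Y \<Longrightarrow> vector_field A (lie_bracket A X Y)"
  by (simp add: lie_bracket_D vector_field_diff vector_field_D)

lemmas vector_field_intros = vector_field_add vector_field_diff vector_field_minus vector_field_J
  vector_field_D vector_field_scaleR vector_field_lie_bracket

definition curv :: "('a \<Rightarrow> 'e) \<Rightarrow> ('a \<Rightarrow> 'e) \<Rightarrow> ('a \<Rightarrow> 'e) \<Rightarrow> 'a \<Rightarrow> 'e" where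
  "curv X Y Z p = D X (D Y Z) p - D Y (D X Z) p - D (lie_bracket A X Y) Z p"

lemma curv_swap: "vector_field A X \<Longrightarrow> vector_field A Y \<Longrightarrow> vector_field A Z \<Longrightarrow> curv Y X Z p = - curv X Y Z p"
  by (simp add: curv_def lie_bracket_D D_diff_left vector_field_intros)

lemma curv_add_left:
  "vector_field A X \<Longrightarrow> vector_field A X' \<Longrightarrow> vector_field A Y \<Longrightarrow> vector_field A Z \<Longrightarrow>
    curv (\<lambda>q. X q + X' q) Y Z p = curv X Y Z p + curv X' Y Z p"
  by (simp add: curv_def lie_bracket_D D_diff_left D_add_left D_add_right vector_field_intros)

lemma curv_add_right:
  "vector_field A X \<Longrightarrow> vector_field A Y \<Longrightarrow> vector_field A Z \<Longrightarrow> vector_field A Z' \<Longrightarrow>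
    curv X Y (\<lambda>q. Z q + Z' q) p = curv X Y Z p + curv X Y Z' p"
  by (simp add: curv_def lie_bracket_D D_diff_left D_add_left D_add_right vector_field_intros)

lemma curv_scale_left:
  "smooth_fun A f \<Longrightarrow> vector_field A X \<Longrightarrow> vector_field A Y \<Longrightarrow> vector_field A Z \<Longrightarrow>
    curv (\<lambda>q. f q *\<^sub>R X q) Y Z p = f p *\<^sub>R curv X Y Z p"
  by (simp add: curv_def lie_bracket_D D_diff_left D_add_left D_scale_left D_scale_right
      vector_field_intros smooth_fun_deriv_along scaleR_diff_right)

text \<open>The terms with first derivatives of \<open>f\<close> are symmetric in \<open>X\<close>
  and \<open>Y\<close> and cancel; those with second derivatives form a commutator, which is the
  derivative of \<open>f\<close> along the bracket.\<close>

lemma curv_scale_right: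
  assumes "smooth_fun A f" "vector_field A X" "vector_field A Y" "vector_field A Z"
  shows "curv X Y (\<lambda>q. f q *\<^sub>R Z q) p = f p *\<^sub>R curv X Y Z p"
proof -
  have DD: "D X (D Y (\<lambda>q. f q *\<^sub>R Z q)) p = deriv_along A X (deriv_along A Y f) p *\<^sub>R Z p
      + deriv_along A Y f p *\<^sub>R D X Z p + deriv_along A X f p *\<^sub>R D Y Z p + f p *\<^sub>R D X (D Y Z) p"
    if "vector_field A X" "vector_field A Y" for X Y
    using assms that by (simp add: D_scale_right D_add_right vector_field_intros smooth_fun_deriv_along)
  have bracket: "D (lie_bracket A X Y) (\<lambda>q. f q *\<^sub>R Z q) p =
     (deriv_along A X (deriv_along A Y f) p - deriv_along A Y (deriv_along A X f) p) *\<^sub>R Z p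
      + f p *\<^sub>R D (lie_bracket A X Y) Z p"
    using assms by (simp add: D_scale_right vector_field_lie_bracket deriv_along_lie_bracket)
  show ?thesis
    unfolding curv_def DD[OF assms(2,3)] DD[OF assms(3,2)] bracket by (simp add: algebra_simps)
qed

lemma curv_scale_middle:
  assumes "smooth_fun A f" "vector_field A X" "vector_field A Y" "vector_field A Z"
  shows "curv X (\<lambda>q. f q *\<^sub>R Y q) Z p = f p *\<^sub>R curv X Y Z p"
  using curv_scale_left[of f Y X Z] curv_swap[of X Y Z] curv_swap[of X "\<lambda>q. f q *\<^sub>R Y q" Z] assms
  by (simp add: vector_field_intros)

lemma curv_add_middle:
  assumes "vector_field A X" "vector_field A Y" "vector_field A Y'" "vector_field A Z"
  shows "curv X (\<lambda>q. Y q + Y' q) Z p = curv X Y Z p + curv X Y' Z p"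
proof -
  have "curv X (\<lambda>q. Y q + Y' q) Z p = - curv (\<lambda>q. Y q + Y' q) X Z p"
    using assms by (intro curv_swap vector_field_add)
  also have "\<dots> = - curv Y X Z p + - curv Y' X Z p"
    using assms by (simp add: curv_add_left)
  also have "\<dots> = curv X Y Z p + curv X Y' Z p"
    using assms by (simp add: curv_swap[of X Y] curv_swap[of X Y'])
  finally show ?thesis .
qed

lemma curv_tensorial:
  assumes "vector_field A X" "vector_field A Y" "vector_field A Z"
    "vector_field A X'" "vector_field A Y'" "vector_field A Z'"
    and eq: "X p = X' p" "Y p = Y' p" "Z p = Z' p"
  shows "curv X Y Z p = curv X' Y' Z' p"
proof -
  have "curv X Y Z p = curv X' Y Z p"
    by (rule tensorial[where p = p and T = "\<lambda>X. curv X Y Z p"])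
      (use assms in \<open>simp_all add: curv_add_left curv_scale_left\<close>)
  also have "\<dots> = curv X' Y' Z p"
    by (rule tensorial[where p = p and T = "\<lambda>Y. curv X' Y Z p"])
      (use assms in \<open>simp_all add: curv_add_middle curv_scale_middle\<close>)
  also have "\<dots> = curv X' Y' Z' p"
    by (rule tensorial[where p = p and T = "\<lambda>Z. curv X' Y' Z p"])
      (use assms in \<open>simp_all add: curv_add_right curv_scale_right\<close>)
  finally show ?thesis .
qed

text \<open>Well-definedness of the \<open>THE\<close> in \<open>curv_op\<close>. From here on
  curvature at a point may be computed with whichever extensions are convenient.\<close>

lemma curv_op_eq:
  assumes "vector_field A X" "vector_field A Y" "vector_field A Z"
  shows "curv_op A D p (X p) (Y p) (Z p) = curv X Y Z p"
  unfolding curv_op_def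
proof (rule the_equality)
  show "\<exists>X' Y' Z'. vector_field A X' \<and> vector_field A Y' \<and> vector_field A Z' \<and>
        X' p = X p \<and> Y' p = Y p \<and> Z' p = Z p \<and>
        curv X Y Z p = D X' (D Y' Z') p - D Y' (D X' Z') p - D (lie_bracket A X' Y') Z' p"
    using assms curv_def by blast
next
  fix v
  assume "\<exists>X' Y' Z'. vector_field A X' \<and> vector_field A Y' \<and> vector_field A Z' \<and>
        X' p = X p \<and> Y' p = Y p \<and> Z' p = Z p \<and>
        v = D X' (D Y' Z') p - D Y' (D X' Z') p - D (lie_bracket A X' Y') Z' p"
  then show "v = curv X Y Z p"
    using curv_tensorial[OF _ _ _ assms] unfolding curv_def by metis
qed

lemma deriv_along_diff_fun:
  assumes "smooth_fun A f" "smooth_fun A h"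
  shows "deriv_along A X (\<lambda>q. f q - h q) p = deriv_along A X f p - deriv_along A X h p"
  using deriv_along_add_fun[OF assms(1) smooth_fun_mult[OF smooth_fun_const assms(2), of "-1"]]
    deriv_along_mult_fun[OF smooth_fun_const assms(2), of X "-1"]
  by (simp add: deriv_along_const)

text \<open>On functions every bracket is a commutator, and the twelve triple derivatives cancel in
  pairs; \<open>deriv_along_separates\<close> carries this back to fields.\<close>

lemma jacobi_identity:
  assumes "vector_field A X" "vector_field A Y" "vector_field A Z"
  shows "lie_bracket A X (lie_bracket A Y Z) p + lie_bracket A Y (lie_bracket A Z X) p
    + lie_bracket A Z (lie_bracket A X Y) p = 0"
proof -
  let ?W = "\<lambda>p. lie_bracket A X (lie_bracket A Y Z) p + lie_bracket A Y (lie_bracket A Z X) p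
    + lie_bracket A Z (lie_bracket A X Y) p"
  have "deriv_along A ?W f p = 0" if f: "smooth_fun A f" for f
  proof -
    have "deriv_along A (\<lambda>p. U p + V p + W p) f p =
        deriv_along A U f p + deriv_along A V f p + deriv_along A W f p" for U V W
      using linear_add[OF linear_deriv_along[OF f, of p]] unfolding deriv_along_def by simp
    moreover have "deriv_along A (lie_bracket A U (lie_bracket A V W)) f p =
      deriv_along A U (deriv_along A V (deriv_along A W f)) p - deriv_along A U (deriv_along A W (deriv_along A V f)) p
      - deriv_along A V (deriv_along A W (deriv_along A U f)) p + deriv_along A W (deriv_along A V (deriv_along A U f)) p"
      if UVW: "vector_field A U" "vector_field A V" "vector_field A W" for U V W
    proof -
      have "deriv_along A (lie_bracket A V W) f = (\<lambda>q. deriv_along A V (deriv_along A W f) q - deriv_along A W (deriv_along A V f) q)"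
        using UVW f by (simp add: deriv_along_lie_bracket fun_eq_iff)
      then show ?thesis
        using UVW f by (simp add: deriv_along_lie_bracket vector_field_lie_bracket smooth_fun_deriv_along deriv_along_diff_fun)
    qed
    ultimately show ?thesis using assms by simp
  qed
  from deriv_along_separates[OF this] show ?thesis .
qed

text \<open>Vanishing torsion turns the cyclic sum of curvatures into the cyclic sum of iterated
  brackets.\<close>

lemma curv_bianchi:
  assumes "vector_field A X" "vector_field A Y" "vector_field A Z"
  shows "curv X Y Z p + curv Y Z X p + curv Z X Y p = 0"
  using jacobi_identity[OF assms, of p] assms
  by (simp add: curv_def lie_bracket_D D_diff_left D_diff_right vector_field_intros algebra_simps)

text \<open>The bracket differentiates the function g(Z,W) in two ways: directly, and as a
  commutator of two derivatives. By metric compatibility the mixed products are symmetric in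
  \<open>X\<close> and \<open>Y\<close>, and comparing the rest gives skewness.\<close>

lemma curv_skew:
  assumes "vector_field A X" "vector_field A Y" "vector_field A Z" "vector_field A W"
  shows "g p (curv X Y Z p) (W p) = - g p (Z p) (curv X Y W p)"
proof -
  have DD: "deriv_along A X (deriv_along A Y (\<lambda>q. g q (Z q) (W q))) p =
     g p (D X (D Y Z) p) (W p) + g p (D Y Z p) (D X W p) + g p (D X Z p) (D Y W p) + g p (Z p) (D X (D Y W) p)"
    if "vector_field A X" "vector_field A Y" for X Y
    using assms that
    by (simp add: deriv_along_g deriv_along_add_fun smooth_fun_g vector_field_intros)
  have "deriv_along A (lie_bracket A X Y) (\<lambda>q. g q (Z q) (W q)) p =
     deriv_along A X (deriv_along A Y (\<lambda>q. g q (Z q) (W q))) p -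
     deriv_along A Y (deriv_along A X (\<lambda>q. g q (Z q) (W q))) p"
    using assms by (simp add: deriv_along_lie_bracket smooth_fun_g)
  then have "g p (D (lie_bracket A X Y) Z p) (W p) + g p (Z p) (D (lie_bracket A X Y) W p) =
     g p (D X (D Y Z) p) (W p) + g p (Z p) (D X (D Y W) p) -
     (g p (D Y (D X Z) p) (W p) + g p (Z p) (D Y (D X W) p))"
    using assms unfolding DD[OF assms(1,2)] DD[OF assms(2,1)]
    by (simp add: deriv_along_g vector_field_intros)
  then show ?thesis by (simp add: curv_def g_simps)
qed

end

section \<open>Algebraic curvature tensors\<close>

locale curvature_tensor =
  fixes T :: "'v::real_vector \<Rightarrow> 'v \<Rightarrow> 'v \<Rightarrow> 'v \<Rightarrow> real"
  assumes add1: "T (x + x') y z w = T x y z w + T x' y z w"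
    and scale1: "T (c *\<^sub>R x) y z w = c * T x y z w"
    and skew12: "T y x z w = - T x y z w"
    and skew34: "T x y w z = - T x y z w"
    and bianchi: "T x y z w + T y z x w + T z x y w = 0"
begin

text \<open>A combination of four Bianchi identities, one for each argument kept in the last place;
  skewness makes the other terms cancel.\<close>

lemma pair_symmetry: "T z w x y = T x y z w"
  using bianchi[of x y z w] bianchi[of y z w x] bianchi[of z w x y] bianchi[of w x y z]
    skew12[of x z y w] skew12[of y w z x] skew34[of y z x w] skew34[of z w y x] skew34[of w x z y]
    skew34[of x y w z] skew12[of x z w y] skew12[of y w x z] skew34[of z x y w] skew34[of w y z x]
    skew34[of x z w y] skew34[of y w x z] skew34[of z x w y] skew34[of w y x z] skew34[of x z y w]
    skew34[of y w z x] skew34[of z w x y] skew34[of x y z w] skew34[of w x y z] skew34[of y z w x]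
    skew12[of w y z x] skew12[of w y x z] skew12[of z x y w] skew12[of z x w y]
  by linarith

text \<open>Carries linearity from slot 1 to slot 4 and from slot 2 to slot 3, which is why the
  locale assumes it in the first slot only.\<close>

lemma reversal: "T w z y x = T x y z w"
  using pair_symmetry[of w z y x] skew12[of x y z w] skew34[of y x z w] pair_symmetry[of y x w z] by linarith

lemma minus1: "T (- x) y z w = - T x y z w"
  using scale1[of "-1" x y z w] by simp

lemma minus2: "T x (- y) z w = - T x y z w"
  using skew12[of x "- y" z w] skew12[of x y z w] minus1[of y x z w] by linarith

lemma minus4: "T x y z (- w) = - T x y z w"
  using reversal[of "- w" z y x] reversal[of w z y x] minus1[of w z y x] by linarith

lemma minus3: "T x y (- z) w = - T x y z w"
  using reversal[of w "- z" y x] reversal[of w z y x] minus2[of w z y x] by linarith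

lemma add2: "T x (y + y') z w = T x y z w + T x y' z w"
  using skew12[of x "y + y'" z w] skew12[of x y z w] skew12[of x y' z w] add1[of y y' x z w] by linarith

lemma add4: "T x y z (w + w') = T x y z w + T x y z w'"
  using reversal[of "w + w'" z y x] reversal[of w z y x] reversal[of w' z y x] add1[of w w' z y x] by linarith

lemma add3: "T x y (z + z') w = T x y z w + T x y z' w"
  using reversal[of w "z + z'" y x] reversal[of w z y x] reversal[of w z' y x] add2[of w z z' y x] by linarith

lemma scale2: "T x (c *\<^sub>R y) z w = c * T x y z w"
  using skew12[of x "c *\<^sub>R y" z w] skew12[of x y z w] scale1[of c y x z w] by simp

lemma scale3: "T x y (c *\<^sub>R z) w = c * T x y z w"
  using reversal[of w "c *\<^sub>R z" y x] reversal[of w z y x] scale2[of w c z y x] by simp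

text \<open>Polarizing twice makes the tensor skew in all arguments, and then the Bianchi identity kills it.\<close>

lemma eq_zero_if_biquadratic_zero:
  assumes "\<And>x y. T x y y x = 0"
  shows "T x y z w = 0"
proof -
  have mid: "T x y z x = 0" for x y z
    using assms[of x "y + z"] assms[of x y] assms[of x z] reversal[of x z y x]
    by (simp add: add2 add3)
  have outer: "T x y z w = - T w y z x" for x y z w
    using mid[of "x + w" y z] mid[of x y z] mid[of w y z] by (simp add: add1 add4)
  show ?thesis
    using bianchi[of x y z w] outer[of y z x w] outer[of z x y w] outer[of x y z w]
      skew12[of z w x y] skew12[of x w y z] skew12[of w y z x] skew34[of w y z x]
      skew12[of y z w x] skew34[of w z x y] skew34[of w x y z]
      outer[of w z y x] outer[of w x z y] outer[of w y x z] skew34[of x z y w] skew34[of y x z w] skew34[of z y x w]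
      skew12[of z x w y] skew12[of z x y w] skew12[of x y z w] skew12[of y z x w] 
    by linarith
qed

end

lemma curvature_tensor_diff:
  assumes "curvature_tensor S" "curvature_tensor T"
  shows "curvature_tensor (\<lambda>x y z w. S x y z w - T x y z w)"
proof -
  interpret S: curvature_tensor S by fact
  interpret T: curvature_tensor T by fact
  show ?thesis
  proof
    show "S x y z w - T x y z w + (S y z x w - T y z x w) + (S z x y w - T z x y w) = 0" for x y z w
      using S.bianchi[of x y z w] T.bianchi[of x y z w] by linarith
    show "S y x z w - T y x z w = - (S x y z w - T x y z w)" for x y z w
      using S.skew12[of x y z w] T.skew12[of x y z w] by linarith
    show "S x y w z - T x y w z = - (S x y z w - T x y z w)" for x y z w
      using S.skew34[of x y z w] T.skew34[of x y z w] by linarith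
  qed (simp_all add: S.add1 T.add1 S.scale1 T.scale1 algebra_simps)
qed

text \<open>Up to a factor, the real part of \<open>T (x - iJx) (y - iJy) (z - iJz) (w - iJw)\<close> for the complex
  multilinear extension of \<open>T\<close>.\<close>

definition gray :: "('v \<Rightarrow> 'v) \<Rightarrow> ('v \<Rightarrow> 'v \<Rightarrow> 'v \<Rightarrow> 'v \<Rightarrow> real) \<Rightarrow> 'v \<Rightarrow> 'v \<Rightarrow> 'v \<Rightarrow> 'v \<Rightarrow> real" where
  "gray J T x y z w = T x y z w + T (J x) (J y) (J z) (J w)
     - T (J x) (J y) z w - T (J x) y (J z) w - T (J x) y z (J w)
     - T x (J y) (J z) w - T x (J y) z (J w) - T x y (J z) (J w)"

section \<open>Vanishing criteria under Gray's identity\<close>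

locale gray_curvature_tensor = curvature_tensor T for T :: "'v::real_vector \<Rightarrow> 'v \<Rightarrow> 'v \<Rightarrow> 'v \<Rightarrow> real" +
  fixes J :: "'v \<Rightarrow> 'v"
  assumes linear_J: "linear J" and J_J: "J (J x) = - x"
    and gray: "gray J T x y z w = 0"
begin

text \<open>At x, y, y, x the terms with one \<open>J\<close> in each half of the argument list come
  in pairs exchanged by \<open>reversal\<close>. This is the only instance of Gray's identity that
  the two criteria below use.\<close>

lemma gray_biquadratic:
  "T x y y x + T (J x) (J y) (J y) (J x) - T (J x) y y (J x) - T x (J y) (J y) x
    = 2 * T (J x) (J y) y x + 2 * T (J x) y (J y) x"
  using gray[of x y y x] reversal[of "J x" "J y" y x] reversal[of "J x" y "J y" x]
  unfolding gray_def by linarith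

text \<open>Each replacement of a repeated argument by its image under \<open>J\<close> changes the
  sign of \<open>?k\<close>, so the left side of \<open>gray_biquadratic\<close> is 4
  \<open>?k\<close>. The polarized hypothesis gives \<open>e1\<close> and \<open>e2\<close>; with
  the Bianchi relation \<open>bi\<close> they force \<open>?r\<close> = 0 and \<open>?p\<close> =
  \<open>?q\<close> = - \<open>?k\<close>, so the right side is -4 \<open>?k\<close>.\<close>

lemma eq_zero_if_jacobi_zero:
  assumes jac: "\<And>x y z. T y x x z + T y (J x) (J x) z = 0"
  shows "T x y z w = 0"
proof (rule eq_zero_if_biquadratic_zero)
  fix x y
  have polarized: "T y a b z + T y b a z + T y (J a) (J b) z + T y (J b) (J a) z = 0" for a b y z
    using jac[of y "a + b" z] jac[of y a z] jac[of y b z]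
    by (simp add: linear_add[OF linear_J] add2 add3)
  let ?k = "T x y y x" and ?p = "T (J x) (J y) y x" and ?q = "T (J x) y (J y) x" and ?r = "T (J x) x (J y) y"
  have k2: "T x (J y) (J y) x = - ?k" using jac[of x y x] by linarith
  have k1: "T (J x) y y (J x) = - ?k"
    using jac[of y x y] reversal[of y x x y] reversal[of y "J x" "J x" y]
      skew12[of y x x y] skew34[of x y x y] skew12[of y "J x" "J x" y] skew34[of "J x" y "J x" y] by linarith
  have k12: "T (J x) (J y) (J y) (J x) = ?k"
    using jac[of "J x" y "J x"] k1 by linarith
  have bi: "- ?p + ?q - ?r = 0"
    using bianchi[of "J x" "J y" x y] skew34[of "J x" "J y" y x] pair_symmetry[of "J y" x "J x" y]
      skew12[of x "J x" "J y" y] skew34[of "J x" y x "J y"] skew34[of "J x" y "J y" x]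
      skew12[of x "J y" "J x" y] skew12[of "J x" x "J y" y] by linarith
  have e1: "- ?p + ?r = ?k"
    using polarized[of "J x" "J y" x y] k1 skew12[of "J x" "J x" y y] skew34[of "J x" "J y" y x] skew34[of "J x" y y "J x"]
    by (simp add: J_J minus2 minus3)
  have e2: "?q + ?r = - ?k"
    using polarized[of "J x" y x "J y"] k12 skew34[of "J x" y "J y" x] skew34[of "J x" x "J y" y]
      skew34[of "J x" "J y" "J y" "J x"] skew12[of "J x" "J x" "J y" "J y"] skew12[of "J x" "J x" y "J y"]
    by (simp add: J_J minus2 minus3)
  show "?k = 0"
    using gray_biquadratic[of x y] k1 k2 k12 bi e1 e2 by linarith
qed

text \<open>Polarization lets \<open>J\<close> move between the two arguments of a pair, so
  \<open>J\<close> applied to both arguments of a pair changes the sign. Bianchi identifies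
  \<open>?p\<close> with \<open>?q\<close>, and the values in \<open>gray_biquadratic\<close> become
  the same as under the Jacobi condition: 4 \<open>?k\<close> against -4 \<open>?k\<close>.\<close>

lemma eq_zero_if_complex_curvature_zero:
  assumes curv: "\<And>x y z. T x (J x) y z = 0"
  shows "T x y z w = 0"
proof (rule eq_zero_if_biquadratic_zero)
  fix x y
  have polarized: "T (J a) b z w = T a (J b) z w" for a b z w
    using curv[of "a + b" z w] curv[of a z w] curv[of b z w] skew12[of b "J a" z w]
    by (simp add: linear_add[OF linear_J] add1 add2)
  let ?k = "T x y y x" and ?p = "T (J x) (J y) y x" and ?q = "T (J x) y (J y) x"
  have JJ: "T (J a) (J b) z w = - T a b z w" for a b z w
    using polarized[of a "J b" z w] by (simp add: J_J minus2)
  have JJ': "T z w (J a) (J b) = - T z w a b" for a b z w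
    using JJ[of a b z w] pair_symmetry[of "J a" "J b" z w] pair_symmetry[of a b z w] by linarith
  have p: "?p = - ?k" by (rule JJ)
  have k12: "T (J x) (J y) (J y) (J x) = ?k" by (simp add: JJ JJ')
  have bi: "- ?p + ?q = 0"
    using bianchi[of "J x" "J y" x y] skew34[of "J x" "J y" y x] pair_symmetry[of "J y" x "J x" y]
      skew12[of x "J x" "J y" y] skew34[of "J x" y x "J y"] skew34[of "J x" y "J y" x]
      skew12[of x "J y" "J x" y] curv[of x "J y" y] by linarith
  have k1: "T (J x) y y (J x) = ?q"
    using polarized[of x y y "J x"] reversal[of "J x" y "J y" x] by linarith
  have k2: "T x (J y) (J y) x = ?q"
    using polarized[of x y "J y" x] by linarith
  show "?k = 0"
    using gray_biquadratic[of x y] p k12 bi k1 k2 by linarith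
qed

end

section \<open>Gray's identity\<close>

context almost_hermitian_manifold
begin

lemma curvature_tensor_curv: "curvature_tensor (curv_tensor A g D p)"
proof
  fix x x' y z w :: 'e and c :: real
  obtain X where X: "vector_field A X" "X p = x" using vector_field_extends by blast
  obtain X' where X': "vector_field A X'" "X' p = x'" using vector_field_extends by blast
  obtain Y where Y: "vector_field A Y" "Y p = y" using vector_field_extends by blast
  obtain Z where Z: "vector_field A Z" "Z p = z" using vector_field_extends by blast
  obtain W where W: "vector_field A W" "W p = w" using vector_field_extends by blast
  note vf = X(1) X'(1) Y(1) Z(1) W(1)
  note at_p = X(2)[symmetric] X'(2)[symmetric] Y(2)[symmetric] Z(2)[symmetric] W(2)[symmetric]
  show "curv_tensor A g D p (x + x') y z w = curv_tensor A g D p x y z w + curv_tensor A g D p x' y z w"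
    unfolding curv_tensor_def at_p
    using vf curv_op_eq[of "\<lambda>q. X q + X' q" Y Z p]
    by (simp add: curv_op_eq curv_add_left g_simps vector_field_add)
  show "curv_tensor A g D p (c *\<^sub>R x) y z w = c * curv_tensor A g D p x y z w"
    unfolding curv_tensor_def at_p
    using vf curv_op_eq[of "\<lambda>q. c *\<^sub>R X q" Y Z p]
    by (simp add: curv_op_eq curv_scale_left[OF smooth_fun_const] g_simps vector_field_cmult)
  show "curv_tensor A g D p y x z w = - curv_tensor A g D p x y z w"
    unfolding curv_tensor_def at_p
    using vf curv_swap[of X Y Z p] by (simp add: curv_op_eq g_simps)
  show "curv_tensor A g D p x y w z = - curv_tensor A g D p x y z w"
    unfolding curv_tensor_def at_p
    using vf curv_skew[of X Y W Z p] by (simp add: curv_op_eq g_commute)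
  show "curv_tensor A g D p x y z w + curv_tensor A g D p y z x w + curv_tensor A g D p z x y w = 0"
  proof -
    have "g p (curv X Y Z p + curv Y Z X p + curv Z X Y p) w = 0"
      using vf by (simp add: curv_bianchi g_simps)
    then show ?thesis
      unfolding curv_tensor_def at_p using vf by (simp add: curv_op_eq g_simps)
  qed
qed

section \<open>Covariant derivatives of the complex structure and the Ricci identity\<close>

abbreviation "Jf X \<equiv> (\<lambda>q. J q (X q))"

definition nJ :: "('a \<Rightarrow> 'e) \<Rightarrow> ('a \<Rightarrow> 'e) \<Rightarrow> 'a \<Rightarrow> 'e" where
  "nJ X Y = (\<lambda>p. D X (Jf Y) p - J p (D X Y p))"

text \<open>With \<open>nJ X Y\<close> as the field \<open>(nabla_X J) Y\<close>, this is the second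
  covariant derivative \<open>(nabla^2_{X,Y} J) Z\<close>; the two subtracted terms are the Leibniz
  corrections for \<open>Y\<close> and \<open>Z\<close>.\<close>

definition nnJ :: "('a \<Rightarrow> 'e) \<Rightarrow> ('a \<Rightarrow> 'e) \<Rightarrow> ('a \<Rightarrow> 'e) \<Rightarrow> 'a \<Rightarrow> 'e" where
  "nnJ X Y Z = (\<lambda>p. D X (nJ Y Z) p - nJ (D X Y) Z p - nJ Y (D X Z) p)"

lemma vector_field_nJ: "vector_field A X \<Longrightarrow> vector_field A Y \<Longrightarrow> vector_field A (nJ X Y)"
  unfolding nJ_def by (intro vector_field_intros)

lemma D_Jf: "D X (Jf Y) = (\<lambda>p. nJ X Y p + J p (D X Y p))"
  by (simp add: nJ_def)

text \<open>The covariant derivative of the relation J^2 = -1.\<close>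

lemma nJ_Jf:
  assumes "vector_field A X" "vector_field A Y"
  shows "nJ X (Jf Y) p = - J p (nJ X Y p)"
  using assms by (simp add: nJ_def J_simps D_minus_right)

lemma deriv_along_minus_fun:
  assumes "smooth_fun A f"
  shows "deriv_along A X (\<lambda>q. - f q) p = - deriv_along A X f p"
  using deriv_along_mult_fun[OF smooth_fun_const assms, of X "-1" p] by (simp add: deriv_along_const)

text \<open>The covariant derivative of the relation g(JY,Z) = -g(Y,JZ): a derivative of a
  skew-adjoint endomorphism is skew-adjoint.\<close>

lemma g_nJ:
  assumes "vector_field A X" "vector_field A Y" "vector_field A Z"
  shows "g p (nJ X Y p) (Z p) = - g p (Y p) (nJ X Z p)"
proof -
  have "g p (D X (Jf Y) p) (Z p) + g p (Jf Y p) (D X Z p) = deriv_along A X (\<lambda>q. g q (Jf Y q) (Z q)) p"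
    by (simp add: deriv_along_g[OF assms(1) vector_field_J[OF assms(2)] assms(3)])
  also have "\<dots> = deriv_along A X (\<lambda>q. - g q (Y q) (Jf Z q)) p"
    by (simp add: g_J_left)
  also have "\<dots> = - deriv_along A X (\<lambda>q. g q (Y q) (Jf Z q)) p"
    by (rule deriv_along_minus_fun) (intro smooth_fun_g vector_field_J assms)
  also have "\<dots> = - (g p (D X Y p) (Jf Z p) + g p (Y p) (D X (Jf Z) p))"
    by (simp add: deriv_along_g[OF assms(1,2) vector_field_J[OF assms(3)]])
  finally have "g p (D X (Jf Y) p) (Z p) + g p (Jf Y p) (D X Z p)
      = - (g p (D X Y p) (Jf Z p) + g p (Y p) (D X (Jf Z) p))" .
  then show ?thesis by (simp add: nJ_def g_simps g_J_left)
qed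

text \<open>The Ricci identity. In \<open>nnJ\<close> the terms with one derivative on either side
  of \<open>J\<close> are symmetric in \<open>X\<close> and \<open>Y\<close> and cancel; vanishing
  torsion combines the two correction terms into the bracket term of the curvature.\<close>

lemma curv_J:
  assumes "vector_field A X" "vector_field A Y" "vector_field A Z"
  shows "curv X Y (Jf Z) p - J p (curv X Y Z p) = nnJ X Y Z p - nnJ Y X Z p"
proof -
  have nn: "nnJ U V Z p = D U (D V (Jf Z)) p - D U (Jf (D V Z)) p - D (D U V) (Jf Z) p
     + J p (D (D U V) Z p) - D V (Jf (D U Z)) p + J p (D V (D U Z) p)"
    if "vector_field A U" "vector_field A V" for U V
    using assms that by (simp add: nnJ_def nJ_def D_diff_right vector_field_intros)
  show ?thesis
    using assms unfolding nn[OF assms(1,2)] nn[OF assms(2,1)]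
    by (simp add: curv_def lie_bracket_D D_diff_left vector_field_intros J_simps)
qed

lemma nJ_add_left: "vector_field A X \<Longrightarrow> vector_field A X' \<Longrightarrow> vector_field A Y \<Longrightarrow>
    nJ (\<lambda>q. X q + X' q) Y p = nJ X Y p + nJ X' Y p"
  by (simp add: nJ_def D_add_left vector_field_J J_simps)

lemma nJ_scale_left: "smooth_fun A f \<Longrightarrow> vector_field A X \<Longrightarrow> vector_field A Y \<Longrightarrow>
    nJ (\<lambda>q. f q *\<^sub>R X q) Y p = f p *\<^sub>R nJ X Y p"
  by (simp add: nJ_def D_scale_left vector_field_J J_simps scaleR_diff_right)

lemma nJ_add_right: "vector_field A X \<Longrightarrow> vector_field A Y \<Longrightarrow> vector_field A Y' \<Longrightarrow>
    nJ X (\<lambda>q. Y q + Y' q) p = nJ X Y p + nJ X Y' p"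
  by (simp add: nJ_def D_add_right vector_field_J J_simps)

lemma nJ_scale_right: "smooth_fun A f \<Longrightarrow> vector_field A X \<Longrightarrow> vector_field A Y \<Longrightarrow>
    nJ X (\<lambda>q. f q *\<^sub>R Y q) p = f p *\<^sub>R nJ X Y p"
  by (simp add: nJ_def D_scale_right vector_field_J J_simps scaleR_diff_right)

lemma nabla_J_eq:
  assumes "vector_field A X" "vector_field A Y"
  shows "nabla_J A D J p (X p) (Y p) = nJ X Y p"
  unfolding nabla_J_def
proof (rule the_equality)
  show "\<exists>X' Y'. vector_field A X' \<and> vector_field A Y' \<and> X' p = X p \<and> Y' p = Y p \<and>
      nJ X Y p = D X' (Jf Y') p - J p (D X' Y' p)"
    using assms by (intro exI[of _ X] exI[of _ Y]) (simp add: nJ_def)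
next
  fix v
  assume "\<exists>X' Y'. vector_field A X' \<and> vector_field A Y' \<and> X' p = X p \<and> Y' p = Y p \<and>
      v = D X' (Jf Y') p - J p (D X' Y' p)"
  then obtain X' Y' where X'Y': "vector_field A X'" "vector_field A Y'" "X' p = X p" "Y' p = Y p"
      and v: "v = nJ X' Y' p" unfolding nJ_def by blast
  have "nJ X' Y' p = nJ X Y' p"
    by (rule tensorial[where p = p and T = "\<lambda>X. nJ X Y' p"])
      (use assms X'Y' in \<open>simp_all add: nJ_add_left nJ_scale_left\<close>)
  also have "\<dots> = nJ X Y p"
    by (rule tensorial[where p = p and T = "\<lambda>Y. nJ X Y p"])
      (use assms X'Y' in \<open>simp_all add: nJ_add_right nJ_scale_right\<close>)
  finally show "v = nJ X Y p" using v by simp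
qed

lemma curv_tensor_J:
  assumes "vector_field A X" "vector_field A Y" "vector_field A Z"
  shows "curv_tensor A g D p (X p) (Y p) (J p (Z p)) w + curv_tensor A g D p (X p) (Y p) (Z p) (J p w)
    = g p (nnJ X Y Z p) w - g p (nnJ Y X Z p) w"
proof -
  have "g p (curv X Y (Jf Z) p - J p (curv X Y Z p)) w = g p (nnJ X Y Z p - nnJ Y X Z p) w"
    using assms by (simp only: curv_J)
  moreover have "curv_op A D p (X p) (Y p) (J p (Z p)) = curv X Y (Jf Z) p"
    using curv_op_eq[of X Y "Jf Z" p] assms by (simp add: vector_field_J)
  ultimately show ?thesis
    using assms by (simp add: curv_tensor_def curv_op_eq g_simps g_J_left)
qed

section \<open>Gray's identity in the Hermitian case\<close>

context
  assumes hermitian: "hermitian A J"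
begin

text \<open>Let \<open>T\<close> be the difference of the two sides. Integrability makes
  \<open>T X Y\<close> symmetric in \<open>X\<close> and \<open>Y\<close>, while metric
  compatibility makes g(T X Y, Z) skew in \<open>Y\<close> and \<open>Z\<close>. A trilinear form
  symmetric in one pair and skew in an overlapping pair equals its own negative after going once
  around the three arguments.\<close>

lemma nJ_Jf_left:
  assumes "vector_field A X" "vector_field A Y"
  shows "nJ (Jf X) Y = (\<lambda>p. J p (nJ X Y p))"
proof
  fix p
  define T where "T X Y = nJ (Jf X) Y p - J p (nJ X Y p)" for X Y
  have sym: "T X Y = T Y X" if "vector_field A X" "vector_field A Y" for X Y
  proof -
    have "nijenhuis A J X Y p = 0" using hermitian that unfolding hermitian_def by blast
    then show ?thesis
      using that
      by (simp add: nijenhuis_def Let_def lie_bracket_D vector_field_J J_simps D_Jf T_def algebra_simps)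
  qed
  have skew: "g p (T X Y) (Z p) = - g p (T X Z) (Y p)"
    if "vector_field A X" "vector_field A Y" "vector_field A Z" for X Y Z
  proof -
    have "g p (nJ X Y p) (J p (Z p)) = g p (Y p) (J p (nJ X Z p))"
      using g_nJ[of X Y "Jf Z" p] that by (simp add: vector_field_J nJ_Jf g_simps)
    then have "g p (J p (nJ X Y p)) (Z p) = - g p (J p (nJ X Z p)) (Y p)"
      using g_commute[of p "Y p" "J p (nJ X Z p)"] by (simp add: g_J_left)
    moreover have "g p (nJ (Jf X) Y p) (Z p) = - g p (nJ (Jf X) Z p) (Y p)"
      using g_nJ[of "Jf X" Y Z p] that g_commute[of p "Y p" "nJ (Jf X) Z p"] by (simp add: vector_field_J)
    ultimately show ?thesis unfolding T_def g_simps by linarith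
  qed
  have "g p (T X Y) (Z p) = 0" if Z: "vector_field A Z" for Z
  proof -
    have "g p (T X Y) (Z p) = - g p (T Z X) (Y p)"
      using skew[OF assms Z] unfolding sym[OF Z assms(1)] .
    also have "\<dots> = g p (T Y Z) (X p)"
      using skew[OF Z assms] unfolding sym[OF assms(2) Z] by linarith
    also have "\<dots> = - g p (T X Y) (Z p)"
      using skew[OF assms(2) Z assms(1)] unfolding sym[OF assms] .
    finally show ?thesis by linarith
  qed
  then have "g p (T X Y) w = 0" for w
    using vector_field_extends[of p w] by blast
  then have "T X Y = 0" by (rule g_nondegenerate)
  then show "nJ (Jf X) Y p = J p (nJ X Y p)" by (simp add: T_def)
qed

text \<open>Differentiating \<open>nJ_Jf_left\<close> also differentiates both occurrences of
  \<open>J\<close>; the bracketed remainder, quadratic in the first derivative of \<open>J\<close>,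
  collects what this produces.\<close>

lemma nnJ_Jf_middle:
  assumes "vector_field A X" "vector_field A Y" "vector_field A Z"
  shows "nnJ X (Jf Y) Z p = J p (nnJ X Y Z p) + (nJ X (nJ Y Z) p - nJ (nJ X Y) Z p)"
  using assms
  by (simp add: nnJ_def nJ_Jf_left D_Jf nJ_add_left vector_field_intros vector_field_nJ J_simps)

text \<open>By \<open>nJ_Jf_left\<close> the remainder in \<open>nnJ_Jf_middle\<close> is complex
  linear in \<open>X\<close>, so its contributions from \<open>X\<close> and \<open>Jf X\<close>
  cancel.\<close>

lemma nnJ_antilinear_part:
  assumes "vector_field A X" "vector_field A Y" "vector_field A Z"
  shows "nnJ X Y Z p + J p (nnJ (Jf X) Y Z p) + J p (nnJ X (Jf Y) Z p) - nnJ (Jf X) (Jf Y) Z p = 0"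
  using assms
  by (simp add: nnJ_Jf_middle vector_field_intros vector_field_nJ J_simps nJ_Jf_left)

lemma gray_identity_hermitian: "gray (J p) (curv_tensor A g D p) x y z w = 0"
proof -
  interpret curvature_tensor "curv_tensor A g D p" by (rule curvature_tensor_curv)
  obtain X where X: "vector_field A X" "X p = x" using vector_field_extends by blast
  obtain Y where Y: "vector_field A Y" "Y p = y" using vector_field_extends by blast
  \<comment> \<open>With \<open>J p z\<close> in the third slot, the Ricci identity pairs the terms
    of \<open>gray\<close> that differ by \<open>J\<close> in the last two slots. The four pairs
    correspond to the four terms of \<open>nnJ_antilinear_part\<close>, alternated in
    \<open>X\<close> and \<open>Y\<close>.\<close>
  obtain Z where Z: "vector_field A Z" "Z p = J p z" using vector_field_extends by blast
  let ?R = "curv_tensor A g D p"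
  note vf = X(1) Y(1) Z(1) X(1)[THEN vector_field_J] Y(1)[THEN vector_field_J]
  have split: "g p (nnJ U V Z p) w - g p (nnJ (Jf U) V Z p) (J p w) - g p (nnJ U (Jf V) Z p) (J p w)
     - g p (nnJ (Jf U) (Jf V) Z p) w = 0" if "vector_field A U" "vector_field A V" for U V
  proof -
    have "g p (nnJ U V Z p + J p (nnJ (Jf U) V Z p) + J p (nnJ U (Jf V) Z p) - nnJ (Jf U) (Jf V) Z p) w = 0"
      using nnJ_antilinear_part[OF that Z(1)] by (simp add: g_simps)
    then show ?thesis by (simp add: g_simps g_J_left)
  qed
  show ?thesis
    using split[OF vf(1,2)] split[OF vf(2,1)]
      curv_tensor_J[OF vf(1,2,3), of p w] curv_tensor_J[OF vf(4,2,3), of p "J p w"]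
      curv_tensor_J[OF vf(1,5,3), of p "J p w"] curv_tensor_J[OF vf(4,5,3), of p w]
    unfolding gray_def X(2) Y(2) Z(2) J_J minus3 minus4 by linarith
qed

end

section \<open>Gray's identity in the nearly Kaehler case\<close>

context
  assumes nearly_kaehler: "nearly_kaehler A D J"
begin

lemma nJ_skew:
  assumes "vector_field A X" "vector_field A Y"
  shows "nJ Y X = (\<lambda>p. - nJ X Y p)"
proof
  fix p
  have diag: "nJ X X p = 0" if "vector_field A X" for X
    using nabla_J_eq[OF that that, of p] nearly_kaehler unfolding nearly_kaehler_def by simp
  have "nJ (\<lambda>q. X q + Y q) (\<lambda>q. X q + Y q) p = 0"
    using assms by (intro diag vector_field_add)
  then have "nJ X Y p + nJ Y X p = 0"
    using assms by (simp add: nJ_add_left nJ_add_right vector_field_add diag)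
  then show "nJ Y X p = - nJ X Y p" by (simp add: eq_neg_iff_add_eq_0 add.commute)
qed

lemma nnJ_skew:
  assumes "vector_field A X" "vector_field A Y" "vector_field A Z"
  shows "nnJ X Z Y p = - nnJ X Y Z p"
  using assms nJ_skew[of Y Z] nJ_skew[of "D X Y" Z] nJ_skew[of Y "D X Z"]
  by (simp add: nnJ_def D_minus_right vector_field_nJ vector_field_D)

text \<open>The derivative of \<open>g_nJ\<close>; the terms in which a field rather than the tensor
  is differentiated are removed by \<open>g_nJ\<close> itself.\<close>

lemma g_nnJ_skew:
  assumes "vector_field A X" "vector_field A Y" "vector_field A Z" "vector_field A W"
  shows "g p (nnJ X Y W p) (Z p) = - g p (nnJ X Y Z p) (W p)"
proof -
  have "g p (D X (nJ Y Z) p) (W p) + g p (nJ Y Z p) (D X W p) = deriv_along A X (\<lambda>q. g q (nJ Y Z q) (W q)) p"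
    by (simp add: deriv_along_g[OF assms(1) vector_field_nJ[OF assms(2,3)] assms(4)])
  also have "\<dots> = deriv_along A X (\<lambda>q. - g q (Z q) (nJ Y W q)) p"
    by (simp only: g_nJ[OF assms(2,3,4)])
  also have "\<dots> = - deriv_along A X (\<lambda>q. g q (Z q) (nJ Y W q)) p"
    by (rule deriv_along_minus_fun) (intro smooth_fun_g vector_field_nJ assms)
  also have "\<dots> = - (g p (D X Z p) (nJ Y W p) + g p (Z p) (D X (nJ Y W) p))"
    by (simp add: deriv_along_g[OF assms(1,3) vector_field_nJ[OF assms(2,4)]])
  finally have "g p (D X (nJ Y Z) p) (W p) + g p (nJ Y Z p) (D X W p)
    = - (g p (D X Z p) (nJ Y W p) + g p (Z p) (D X (nJ Y W) p))" .
  moreover have "g p (nJ (D X Y) Z p) (W p) = - g p (Z p) (nJ (D X Y) W p)"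
    "g p (nJ Y (D X Z) p) (W p) = - g p (D X Z p) (nJ Y W p)"
    "g p (nJ Y Z p) (D X W p) = - g p (Z p) (nJ Y (D X W) p)"
    using assms by (simp_all add: g_nJ vector_field_D)
  ultimately show ?thesis
    by (simp add: nnJ_def g_simps g_commute[of p _ "Z p"])
qed

text \<open>Let \<open>b X Y Z W\<close> be the Gray expression of \<open>(X,Y,Z,W) \<mapsto> g ((\<nabla>\<^sup>2\<^sub>X\<^sub>Y J) Z) W\<close>. By the Ricci
  identity the alternation of \<open>b\<close> in \<open>X, Y\<close> is twice that of the curvature at \<open>(X,Y,Z,JW)\<close>, so the first
  Bianchi identity makes the cyclic sums of \<open>b\<close> over \<open>X, Y, Z\<close> vanish. As \<open>b\<close> is skew
  in \<open>Y, Z, W\<close>, this forces \<open>b = 0\<close>.\<close>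

lemma gray_identity_nearly_kaehler: "gray (J p) (curv_tensor A g D p) x y z w = 0"
proof -
  interpret curvature_tensor "curv_tensor A g D p" by (rule curvature_tensor_curv)
  let ?R = "curv_tensor A g D p"
  let ?n = "\<lambda>X Y Z W. g p (nnJ X Y Z p) (W p)"
  let ?v = "\<lambda>X. vector_field A X"
  define b where "b X Y Z W = ?n X Y Z W + ?n (Jf X) (Jf Y) (Jf Z) (Jf W)
     - ?n (Jf X) (Jf Y) Z W - ?n (Jf X) Y (Jf Z) W - ?n (Jf X) Y Z (Jf W)
     - ?n X (Jf Y) (Jf Z) W - ?n X (Jf Y) Z (Jf W) - ?n X Y (Jf Z) (Jf W)" for X Y Z W
  have n23: "g p (nnJ X Z Y p) w = - g p (nnJ X Y Z p) w" if "?v X" "?v Y" "?v Z" for X Y Z w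
    using nnJ_skew[OF that, of p] by (simp add: g_simps)
  have n34: "?n X Y W Z = - ?n X Y Z W" if "?v X" "?v Y" "?v Z" "?v W" for X Y Z W
    using g_nnJ_skew[OF that] .
  have b23: "b X Z Y W = - b X Y Z W" if "?v X" "?v Y" "?v Z" for X Y Z W
    unfolding b_def using that by (simp add: n23[of _ Y Z] n23[of _ "Jf Y" Z] n23[of _ Y "Jf Z"]
        n23[of _ "Jf Y" "Jf Z"] vector_field_J)
  have b34: "b X Y W Z = - b X Y Z W" if "?v X" "?v Y" "?v Z" "?v W" for X Y Z W
    unfolding b_def using that by (simp add: n34[of _ _ Z W] n34[of _ _ "Jf Z" W] n34[of _ _ Z "Jf W"]
        n34[of _ _ "Jf Z" "Jf W"] vector_field_J)
  \<comment> \<open>The Gray expression is complex linear in each slot, so it does not matter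
    whether \<open>J p\<close> sits in the third or the fourth one. The two curvature sums coming
    from \<open>curv_tensor_J\<close> therefore coincide, whence the factor 2.\<close>
  have ricci: "2 * gray (J p) ?R (X p) (Y p) (Z p) (J p (W p)) = b X Y Z W - b Y X Z W"
    if "?v X" "?v Y" "?v Z" "?v W" for X Y Z W
  proof -
    have n: "?R (X p) (Y p) (J p (Z p)) (W p) + ?R (X p) (Y p) (Z p) (J p (W p)) = ?n X Y Z W - ?n Y X Z W"
      if "?v X" "?v Y" "?v Z" for X Y Z W
      using curv_tensor_J[OF that] .
    show ?thesis
      using n[of X Y Z W] n[of "Jf X" "Jf Y" "Jf Z" "Jf W"] n[of "Jf X" "Jf Y" Z W] n[of "Jf X" Y "Jf Z" W]
        n[of "Jf X" Y Z "Jf W"] n[of X "Jf Y" "Jf Z" W] n[of X "Jf Y" Z "Jf W"] n[of X Y "Jf Z" "Jf W"] that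
      unfolding b_def gray_def by (simp add: vector_field_J J_J minus1 minus2 minus3 minus4)
  qed
  have gray_bianchi: "gray (J p) ?R x y z w + gray (J p) ?R y z x w + gray (J p) ?R z x y w = 0" for x y z w
    using bianchi[of x y z w] bianchi[of "J p x" "J p y" "J p z" "J p w"] bianchi[of "J p x" "J p y" z w]
      bianchi[of "J p x" y "J p z" w] bianchi[of x "J p y" "J p z" w] bianchi[of "J p x" y z "J p w"]
      bianchi[of x "J p y" z "J p w"] bianchi[of x y "J p z" "J p w"]
    unfolding gray_def by linarith
  have cyclic: "b X Y Z W + b Y Z X W + b Z X Y W = 0" if "?v X" "?v Y" "?v Z" "?v W" for X Y Z W
    using gray_bianchi[of "X p" "Y p" "Z p" "J p (W p)"]
      ricci[of X Y Z W] ricci[of Y Z X W] ricci[of Z X Y W]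
      b23[of X Y Z W] b23[of Y Z X W] b23[of Z X Y W] that by simp
  \<comment> \<open>Skewness in the last three arguments leaves four unknowns, according to which
    field stands first. The cyclic identities for the four choices of the last argument form a
    nonsingular linear system for them.\<close>
  have b0: "b X Y Z W = 0" if "?v X" "?v Y" "?v Z" "?v W" for X Y Z W
    using cyclic[of X Y Z W] cyclic[of Y Z W X] cyclic[of Z W X Y] cyclic[of W X Y Z]
      b23[of X Y Z W] b34[of X Y Z W] b23[of X Y W Z] b23[of X Z W Y] b34[of X Z Y W] b34[of X W Y Z]
      b23[of Y X Z W] b34[of Y X Z W] b23[of Y X W Z] b23[of Y Z W X] b34[of Y Z X W] b34[of Y W X Z]
      b23[of Z X Y W] b34[of Z X Y W] b23[of Z X W Y] b23[of Z Y W X] b34[of Z Y X W] b34[of Z W X Y]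
      b23[of W X Y Z] b34[of W X Y Z] b23[of W X Z Y] b23[of W Y Z X] b34[of W Y X Z] b34[of W Z X Y] that
    by simp
  obtain X where X: "?v X" "X p = x" using vector_field_extends by blast
  obtain Y where Y: "?v Y" "Y p = y" using vector_field_extends by blast
  obtain Z where Z: "?v Z" "Z p = z" using vector_field_extends by blast
  \<comment> \<open>Chosen so that \<open>J p (W p)\<close>, the last argument in
    \<open>ricci\<close>, is \<open>w\<close>.\<close>
  obtain W where W: "?v W" "W p = - J p w" using vector_field_extends by blast
  from ricci[OF X(1) Y(1) Z(1) W(1)] b0[OF X(1) Y(1) Z(1) W(1)] b0[OF Y(1) X(1) Z(1) W(1)]
  show ?thesis by (simp add: X(2) Y(2) Z(2) W(2) J_simps)
qed

end

end

section \<open>Complex lines\<close>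

context almost_hermitian_manifold
begin

abbreviation "R \<equiv> curv_op A D"

lemma gray_identity:
  assumes "hermitian A J \<or> nearly_kaehler A D J"
  shows "gray (J p) (curv_tensor A g D p) x y z w = 0"
  using assms gray_identity_hermitian gray_identity_nearly_kaehler by blast

lemma curv_op_eqI:
  assumes "\<And>w. g p v w = g p v' w"
  shows "v = v'"
  using g_nondegenerate[of p "v - v'"] assms by (simp add: g_simps)

lemma curv_op_linear:
  "R p (x + x') y z = R p x y z + R p x' y z" "R p (c *\<^sub>R x) y z = c *\<^sub>R R p x y z"
  "R p x (y + y') z = R p x y z + R p x y' z" "R p x (c *\<^sub>R y) z = c *\<^sub>R R p x y z"
  "R p x y (z + z') = R p x y z + R p x y z'" "R p x y (c *\<^sub>R z) = c *\<^sub>R R p x y z"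
proof -
  interpret curvature_tensor "curv_tensor A g D p" by (rule curvature_tensor_curv)
  note c = curv_tensor_def[of A g D p, symmetric]
  show "R p (x + x') y z = R p x y z + R p x' y z" by (rule curv_op_eqI[of p]) (simp only: g_simps c add1)
  show "R p (c *\<^sub>R x) y z = c *\<^sub>R R p x y z" by (rule curv_op_eqI[of p]) (simp only: g_simps c scale1 real_scaleR_def)
  show "R p x (y + y') z = R p x y z + R p x y' z" by (rule curv_op_eqI[of p]) (simp only: g_simps c add2)
  show "R p x (c *\<^sub>R y) z = c *\<^sub>R R p x y z" by (rule curv_op_eqI[of p]) (simp only: g_simps c scale2 real_scaleR_def)
  show "R p x y (z + z') = R p x y z + R p x y z'" by (rule curv_op_eqI[of p]) (simp only: g_simps c add3)
  show "R p x y (c *\<^sub>R z) = c *\<^sub>R R p x y z" by (rule curv_op_eqI[of p]) (simp only: g_simps c scale3 real_scaleR_def)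
qed

lemma curv_op_swap: "R p y x z = - R p x y z"
proof -
  interpret curvature_tensor "curv_tensor A g D p" by (rule curvature_tensor_curv)
  show ?thesis
    by (rule curv_op_eqI[of p]) (simp only: g_simps curv_tensor_def[of A g D p, symmetric] skew12[of y x])
qed

lemma g_self_J: "g p x (J p x) = 0"
  using g_J_left[of p x x] g_commute[of p x "J p x"] by linarith

text \<open>The unit vectors of a complex line are the rotations of one of them by a cosine
  \<open>a\<close> and a sine \<open>b\<close>. The complex curvature operator is invariant because
  the curvature is skew in its first pair.\<close>

lemma curv_op_unit:
  assumes "a * a + b * b = 1"
  shows "R p (a *\<^sub>R x + b *\<^sub>R J p x) (J p (a *\<^sub>R x + b *\<^sub>R J p x)) y = R p x (J p x) y"
proof -
  have self: "R p u u y = 0" for u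
    using curv_op_swap[of p u u y] by (simp add: eq_neg_iff_add_eq_0 flip: scaleR_2)
  have neg: "R p u (- v) y = - R p u v y" for u v
    using curv_op_linear(4)[of p u "-1" v y] by simp
  have "R p (a *\<^sub>R x + b *\<^sub>R J p x) (J p (a *\<^sub>R x + b *\<^sub>R J p x)) y = (a * a + b * b) *\<^sub>R R p x (J p x) y"
    by (simp add: J_simps curv_op_linear self neg curv_op_swap[of p "J p x" x] flip: scaleR_minus_right)
      (simp add: scaleR_add_left)
  then show ?thesis using assms by simp
qed

text \<open>The rotation acts on \<open>x\<close> and \<open>J p x\<close> simultaneously, and the
  cross terms of the two quadratic expressions have opposite signs.\<close>

lemma jacobi_unit:
  assumes "a * a + b * b = 1"
  shows "jacobi_op A D p (a *\<^sub>R x + b *\<^sub>R J p x) y + jacobi_op A D p (J p (a *\<^sub>R x + b *\<^sub>R J p x)) y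
    = jacobi_op A D p x y + jacobi_op A D p (J p x) y"
proof -
  have neg: "R p u (- v) y = - R p u v y" "R p u v (- y) = - R p u v y" for u v y
    using curv_op_linear(4)[of p u "-1" v y] curv_op_linear(6)[of p u v "-1" y] by simp_all
  have diff: "R p u (v - v') y = R p u v y - R p u v' y" "R p u v (y - y') = R p u v y - R p u v y'" for u v v' y y'
    using curv_op_linear(3)[of p u v "- v'" y] curv_op_linear(5)[of p u v y "- y'"] by (simp_all add: neg)
  have "jacobi_op A D p (a *\<^sub>R x + b *\<^sub>R J p x) y + jacobi_op A D p (J p (a *\<^sub>R x + b *\<^sub>R J p x)) y
    = (a * a + b * b) *\<^sub>R (jacobi_op A D p x y + jacobi_op A D p (J p x) y)"
    by (simp add: jacobi_op_def J_simps curv_op_linear neg diff algebra_simps)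
  then show ?thesis using assms by simp
qed

lemma independent_J:
  assumes "x \<noteq> 0"
  shows "independent {x, J p x}" "x \<noteq> J p x"
proof -
  have ne: "J p x \<noteq> c *\<^sub>R x" for c
  proof
    assume "J p x = c *\<^sub>R x"
    then have "c * g p x x = 0" using g_self_J[of p x] by (simp add: g_simps)
    then have "c = 0" using g_pos[OF assms, of p] by simp
    then have "J p x = 0" using \<open>J p x = c *\<^sub>R x\<close> by simp
    then show False using J_J[of p x] assms by (simp add: J_simps)
  qed
  show "x \<noteq> J p x" using ne[of 1] by auto
  have "independent {x}" using assms by simp
  moreover have "J p x \<notin> span {x}" using ne by (auto simp: span_singleton)
  ultimately have "independent {J p x, x}" by (simp add: independent_insert)
  then show "independent {x, J p x}" by (simp add: insert_commute)
qed

lemma complex_line_span: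
  assumes "L \<in> complex_lines (J p)" "x \<in> L" "x \<noteq> 0"
  shows "L = span {x, J p x}"
proof -
  have L: "subspace L" "dim L = 2" "J p ` L = L" using assms(1) by (auto simp: complex_lines_def)
  have "{x, J p x} \<subseteq> L" using L(3) assms(2) by blast
  moreover have "dim L \<le> card {x, J p x}" using independent_J(2)[OF assms(3), of p] L(2) by simp
  ultimately have "L \<subseteq> span {x, J p x}"
    using independent_J(1)[OF assms(3), of p] by (intro card_ge_dim_independent)
  then show ?thesis using \<open>{x, J p x} \<subseteq> L\<close> L(1) span_minimal by blast
qed

lemma span_complex_line:
  assumes "x \<noteq> 0"
  shows "span {x, J p x} \<in> complex_lines (J p)"
proof -
  have "J p ` span {x, J p x} = span (J p ` {x, J p x})" by (rule linear_span_image[OF linear_J, symmetric])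
  also have "J p ` {x, J p x} = {J p x, - x}" by (simp add: J_J)
  also have "span {J p x, - x} = span {x, J p x}"
  proof
    have "{J p x, - x} \<subseteq> span {x, J p x}" by (simp add: span_base span_neg)
    then show "span {J p x, - x} \<subseteq> span {x, J p x}" by (simp add: span_minimal)
    have "- (- x) \<in> span {J p x, - x}" by (intro span_neg span_base) simp
    then have "{x, J p x} \<subseteq> span {J p x, - x}" by (simp add: span_base)
    then show "span {x, J p x} \<subseteq> span {J p x, - x}" by (simp add: span_minimal)
  qed
  finally show ?thesis
    using independent_J[OF assms, of p] by (simp add: complex_lines_def dim_eq_card_independent)
qed

lemma unit_vec_complex_line:
  assumes "L \<in> complex_lines (J p)"
  shows "unit_vec (g p) L \<in> L" "g p (unit_vec (g p) L) (unit_vec (g p) L) = 1"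
proof -
  have L: "subspace L" "dim L = 2" using assms by (auto simp: complex_lines_def)
  then obtain x where x: "x \<in> L" "x \<noteq> 0"
    by (metis dim_eq_0 subsetI insertI1 empty_iff singletonI subset_singletonD zero_neq_numeral)
  define c where "c = 1 / sqrt (g p x x)"
  have "c * (c * g p x x) = 1" using g_pos[OF x(2), of p] by (simp add: c_def)
  then have "c *\<^sub>R x \<in> L \<and> g p (c *\<^sub>R x) (c *\<^sub>R x) = 1"
    using x L(1) by (simp add: g_simps subspace_scale)
  then have "\<exists>x. x \<in> L \<and> g p x x = 1" by blast
  from someI_ex[OF this] show "unit_vec (g p) L \<in> L" "g p (unit_vec (g p) L) (unit_vec (g p) L) = 1"
    unfolding unit_vec_def by blast+
qed

lemma unit_vecs_of_complex_line:
  assumes "L \<in> complex_lines (J p)" "x \<in> L" "g p x x = 1" "x' \<in> L" "g p x' x' = 1"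
  obtains a b where "x' = a *\<^sub>R x + b *\<^sub>R J p x" "a * a + b * b = 1"
proof -
  have "x \<noteq> 0" using assms(3) by (auto simp: g_simps)
  from complex_line_span[OF assms(1,2) this] assms(4) have "x' \<in> span {x, J p x}" by simp
  then obtain a b where ab: "x' = a *\<^sub>R x + b *\<^sub>R J p x" by (auto simp: span_insert span_singleton algebra_simps)
  have "g p x' x' = a * a + b * b"
    unfolding ab using assms(3) g_self_J[of p x] g_commute[of p "J p x" x]
    by (simp add: g_simps g_J_J)
  with ab assms(5) that show ?thesis by simp
qed

text \<open>Eliminates the \<open>SOME\<close> in \<open>unit_vec\<close>. This matters because the
  vector chosen in the image of a line need not be the image of the vector chosen in the
  line.\<close>

lemma complex_curv_op_eq:
  assumes "L \<in> complex_lines (J p)" "x \<in> L" "g p x x = 1"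
  shows "complex_curv_op A g J D p L y = R p x (J p x) y"
  using unit_vecs_of_complex_line[OF assms unit_vec_complex_line[OF assms(1)]] curv_op_unit
  unfolding complex_curv_op_def Let_def by metis

lemma complex_jacobi_op_eq:
  assumes "L \<in> complex_lines (J p)" "x \<in> L" "g p x x = 1"
  shows "complex_jacobi_op A g J D p L y = R p y x x + R p y (J p x) (J p x)"
proof -
  obtain a b where ab: "unit_vec (g p) L = a *\<^sub>R x + b *\<^sub>R J p x" "a * a + b * b = 1"
    using unit_vecs_of_complex_line[OF assms unit_vec_complex_line[OF assms(1)]] by blast
  show ?thesis
    unfolding complex_jacobi_op_def Let_def ab(1) jacobi_unit[OF ab(2)] by (simp add: jacobi_op_def)
qed

end

section \<open>The equivalence\<close>

lemma curvature_tensor_pullback: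
  assumes "curvature_tensor T" and "linear \<theta>"
  shows "curvature_tensor (\<lambda>x y z w. T (\<theta> x) (\<theta> y) (\<theta> z) (\<theta> w))"
proof -
  interpret curvature_tensor T by fact
  show ?thesis
    by unfold_locales (simp_all only: linear_add[OF assms(2)] linear_scale[OF assms(2)] add1 scale1 bianchi, rule skew12, rule skew34)
qed

lemma complex_isometry_complex_lines:
  assumes "linear \<theta>" "inj \<theta>" "\<And>x. \<theta> (j1 x) = j2 (\<theta> x)" "L \<in> complex_lines j1"
  shows "\<theta> ` L \<in> complex_lines j2"
proof -
  have L: "subspace L" "dim L = 2" "j1 ` L = L" using assms(4) by (auto simp: complex_lines_def)
  have "j2 ` \<theta> ` L = \<theta> ` j1 ` L" by (simp add: image_image assms(3))
  then show ?thesis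
    using L assms by (simp add: complex_lines_def linear_subspace_image dim_image_eq inj_on_subset)
qed

theorem theorem1p2:
  fixes A1 :: "('a::{t2_space,second_countable_topology}, 'e::euclidean_space) chart set"
    and g1 :: "'a \<Rightarrow> 'e \<Rightarrow> 'e \<Rightarrow> real" and J1 :: "'a \<Rightarrow> 'e \<Rightarrow> 'e"
    and D1 :: "('a \<Rightarrow> 'e) \<Rightarrow> ('a \<Rightarrow> 'e) \<Rightarrow> 'a \<Rightarrow> 'e"
    and A2 :: "('b::{t2_space,second_countable_topology}, 'f::euclidean_space) chart set"
    and g2 :: "'b \<Rightarrow> 'f \<Rightarrow> 'f \<Rightarrow> real" and J2 :: "'b \<Rightarrow> 'f \<Rightarrow> 'f"
    and D2 :: "('b \<Rightarrow> 'f) \<Rightarrow> ('b \<Rightarrow> 'f) \<Rightarrow> 'b \<Rightarrow> 'f"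
    and P :: 'a and Q :: 'b and \<theta> :: "'e \<Rightarrow> 'f"
  assumes "almost_hermitian A1 g1 J1" and "levi_civita A1 g1 D1"
    and "hermitian A1 J1 \<or> nearly_kaehler A1 D1 J1"
    and "almost_hermitian A2 g2 J2" and "levi_civita A2 g2 D2"
    and "hermitian A2 J2 \<or> nearly_kaehler A2 D2 J2"
    and "complex_isometry (g1 P) (J1 P) (g2 Q) (J2 Q) \<theta>"
  shows "((\<forall>L\<in>complex_lines (J1 P).
            \<theta> \<circ> complex_jacobi_op A1 g1 J1 D1 P L = complex_jacobi_op A2 g2 J2 D2 Q (\<theta> ` L) \<circ> \<theta>)
          \<longleftrightarrow>
          (\<forall>L\<in>complex_lines (J1 P).
            \<theta> \<circ> complex_curv_op A1 g1 J1 D1 P L = complex_curv_op A2 g2 J2 D2 Q (\<theta> ` L) \<circ> \<theta>))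
       \<and> ((\<forall>L\<in>complex_lines (J1 P).
            \<theta> \<circ> complex_curv_op A1 g1 J1 D1 P L = complex_curv_op A2 g2 J2 D2 Q (\<theta> ` L) \<circ> \<theta>)
          \<longleftrightarrow>
          (\<forall>x y z w. curv_tensor A2 g2 D2 Q (\<theta> x) (\<theta> y) (\<theta> z) (\<theta> w)
                   = curv_tensor A1 g1 D1 P x y z w))"
  (is "(?jac \<longleftrightarrow> ?curv) \<and> (_ \<longleftrightarrow> ?tensor)")
proof -
  interpret M1: almost_hermitian_manifold A1 g1 J1 D1 by unfold_locales fact+
  interpret M2: almost_hermitian_manifold A2 g2 J2 D2 by unfold_locales fact+
  have \<theta>: "linear \<theta>" "bij \<theta>" "\<And>x y. g2 Q (\<theta> x) (\<theta> y) = g1 P x y" "\<And>x. \<theta> (J1 P x) = J2 Q (\<theta> x)"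
    using assms(7) by (simp_all add: complex_isometry_def fun_eq_iff)
  have lines: "\<theta> ` L \<in> complex_lines (J2 Q)" if "L \<in> complex_lines (J1 P)" for L
    using complex_isometry_complex_lines[OF \<theta>(1) bij_is_inj[OF \<theta>(2)] \<theta>(4) that] .
  let ?R1 = "curv_op A1 D1 P" and ?R2 = "curv_op A2 D2 Q"
  have jac_eq: "\<theta> \<circ> complex_jacobi_op A1 g1 J1 D1 P L = complex_jacobi_op A2 g2 J2 D2 Q (\<theta> ` L) \<circ> \<theta> \<longleftrightarrow>
     (\<forall>y. \<theta> (?R1 y x x + ?R1 y (J1 P x) (J1 P x)) =
        ?R2 (\<theta> y) (\<theta> x) (\<theta> x) + ?R2 (\<theta> y) (\<theta> (J1 P x)) (\<theta> (J1 P x)))"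
    if "L \<in> complex_lines (J1 P)" "x \<in> L" "g1 P x x = 1" for L x
    using M1.complex_jacobi_op_eq[OF that] M2.complex_jacobi_op_eq[OF lines[OF that(1)], of "\<theta> x"] that \<theta>(3,4)
    by (simp add: fun_eq_iff)
  have curv_eq: "\<theta> \<circ> complex_curv_op A1 g1 J1 D1 P L = complex_curv_op A2 g2 J2 D2 Q (\<theta> ` L) \<circ> \<theta> \<longleftrightarrow>
     (\<forall>y. \<theta> (?R1 x (J1 P x) y) = ?R2 (\<theta> x) (\<theta> (J1 P x)) (\<theta> y))"
    if "L \<in> complex_lines (J1 P)" "x \<in> L" "g1 P x x = 1" for L x
    using M1.complex_curv_op_eq[OF that] M2.complex_curv_op_eq[OF lines[OF that(1)], of "\<theta> x"] that \<theta>(3,4)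
    by (simp add: fun_eq_iff)
  let ?T = "\<lambda>x y z w. curv_tensor A2 g2 D2 Q (\<theta> x) (\<theta> y) (\<theta> z) (\<theta> w) - curv_tensor A1 g1 D1 P x y z w"
  have "curvature_tensor ?T"
    by (rule curvature_tensor_diff[OF curvature_tensor_pullback[OF M2.curvature_tensor_curv \<theta>(1)] M1.curvature_tensor_curv])
  \<comment> \<open>The Gray expression is linear in the tensor, and the isometry intertwines the
    two complex structures, so it commutes with the pullback.\<close>
  moreover have "gray (J1 P) ?T x y z w = 0" for x y z w
  proof -
    have "gray (J1 P) ?T x y z w = gray (J2 Q) (curv_tensor A2 g2 D2 Q) (\<theta> x) (\<theta> y) (\<theta> z) (\<theta> w)
      - gray (J1 P) (curv_tensor A1 g1 D1 P) x y z w"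
      unfolding gray_def \<theta>(4) by linarith
    then show ?thesis
      using M1.gray_identity[OF assms(3)] M2.gray_identity[OF assms(6)] by simp
  qed
  ultimately interpret T: gray_curvature_tensor ?T "J1 P"
    by (intro gray_curvature_tensor.intro gray_curvature_tensor_axioms.intro M1.linear_J M1.J_J)
  have normalize: "\<exists>c u L. x = c *\<^sub>R u \<and> L \<in> complex_lines (J1 P) \<and> u \<in> L \<and> g1 P u u = 1" for x
  proof -
    have *: ?thesis if "x = c *\<^sub>R u" "g1 P u u = 1" for c u
    proof -
      have "u \<noteq> 0" using that(2) by (auto simp: M1.g_simps)
      from M1.span_complex_line[OF this, of P] show ?thesis
        using that by (intro exI[of _ c] exI[of _ u] exI[of _ "span {u, J1 P u}"]) (simp add: span_base)
    qed
    obtain b :: 'e where "b \<noteq> 0" using nonzero_Basis SOME_Basis by blast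
    \<comment> \<open>A zero vector spans no line. It is written as 0 times the normalization of the
      basis vector \<open>b\<close>, so that every \<open>x\<close> is a multiple of a unit vector
      in some complex line.\<close>
    define y where "y = (if x = 0 then b else x)"
    have "g1 P y y > 0" using M1.g_pos \<open>b \<noteq> 0\<close> by (simp add: y_def)
    then have "g1 P ((1 / sqrt (g1 P y y)) *\<^sub>R y) ((1 / sqrt (g1 P y y)) *\<^sub>R y) = 1"
      by (simp add: M1.g_simps)
    moreover have "x = (if x = 0 then 0 else sqrt (g1 P y y)) *\<^sub>R ((1 / sqrt (g1 P y y)) *\<^sub>R y)"
      using \<open>g1 P y y > 0\<close> by (auto simp: y_def split: if_splits)
    ultimately show ?thesis using * by blast
  qed
  have jac: ?tensor if ?jac
  proof -
    have "?T y x x z + ?T y (J1 P x) (J1 P x) z = 0" for x y z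
    proof -
      obtain c u L where u: "x = c *\<^sub>R u" "L \<in> complex_lines (J1 P)" "u \<in> L" "g1 P u u = 1"
        using normalize by blast
      have "g2 Q (\<theta> (?R1 y u u + ?R1 y (J1 P u) (J1 P u))) (\<theta> z) =
        g2 Q (?R2 (\<theta> y) (\<theta> u) (\<theta> u) + ?R2 (\<theta> y) (\<theta> (J1 P u)) (\<theta> (J1 P u))) (\<theta> z)"
        using that u(2) jac_eq[OF u(2-4)] by simp
      then have "?T y u u z + ?T y (J1 P u) (J1 P u) z = 0"
        unfolding \<theta>(3) by (simp add: curv_tensor_def M1.g_simps M2.g_simps)
      \<comment> \<open>The hypothesis concerns unit vectors only, but the expression is quadratic
        in \<open>u\<close>, so it passes to all multiples with a factor of \<open>c\<close> from
        each of the two slots.\<close>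
      then have "c * (c * (?T y u u z + ?T y (J1 P u) (J1 P u) z)) = 0" by simp
      then show ?thesis
        unfolding u(1) linear_scale[OF M1.linear_J] T.scale2 T.scale3 by (simp only: distrib_left)
    qed
    from T.eq_zero_if_jacobi_zero[OF this] show ?thesis by simp
  qed
  have curv: ?tensor if ?curv
  proof -
    have "?T x (J1 P x) y z = 0" for x y z
    proof -
      obtain c u L where u: "x = c *\<^sub>R u" "L \<in> complex_lines (J1 P)" "u \<in> L" "g1 P u u = 1"
        using normalize by blast
      have "g2 Q (\<theta> (?R1 u (J1 P u) y)) (\<theta> z) = g2 Q (?R2 (\<theta> u) (\<theta> (J1 P u)) (\<theta> y)) (\<theta> z)"
        using that u(2) curv_eq[OF u(2-4)] by simp
      then have "?T u (J1 P u) y z = 0"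
        unfolding \<theta>(3) by (simp add: curv_tensor_def)
      then have "c * (c * ?T u (J1 P u) y z) = 0" by simp
      then show ?thesis
        unfolding u(1) linear_scale[OF M1.linear_J] T.scale1 T.scale2 .
    qed
    from T.eq_zero_if_complex_curvature_zero[OF this] show ?thesis by simp
  qed
  have tensor: "?jac \<and> ?curv" if ?tensor
  proof -
    have R: "\<theta> (?R1 x y z) = ?R2 (\<theta> x) (\<theta> y) (\<theta> z)" for x y z
    proof (rule M2.curv_op_eqI[of Q])
      fix v
      \<comment> \<open>Surjectivity is essential here: the assumption on tensors tests the
        curvature of the second manifold only against vectors in the image.\<close>
      obtain w where "v = \<theta> w" using bij_is_surj[OF \<theta>(2)] by (metis surjD)
      then show "g2 Q (\<theta> (?R1 x y z)) v = g2 Q (?R2 (\<theta> x) (\<theta> y) (\<theta> z)) v"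
        using that \<theta>(3) by (simp add: curv_tensor_def)
    qed
    then show ?thesis
      using jac_eq[OF _ M1.unit_vec_complex_line] curv_eq[OF _ M1.unit_vec_complex_line]
      by (simp add: linear_add[OF \<theta>(1)])
  qed
  show ?thesis using jac curv tensor by blast
qed

end
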